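(* Consider the random Bernoulli cocycle generated by the matrices $$C=\begin{bmatrix}0&-1\\1&0\end{bmatrix},\qquad D=\begin{bmatrix}e&0\\0&e^{-1}\end{bmatrix}$$ with probabilities $(\frac12,\frac12)$. For any $\gamma>1$ and any $\beta\ge1$, the Lyapunov exponent, as a function on the space of random Bernoulli cocycles $(A_1,A_2)\in \mathrm{SL}_2(\mathbb{R})^2$ with probabilities $(\frac12,\frac12)$, is not $(\gamma,\beta)$-log-Hölder continuous at the cocycle $(C,D)$. In particular, it is not weak-Hölder continuous or Hölder continuous at $(C,D)$.
   Context: Cocycles. A pair $A=(A_1,A_2)\in\mathrm{SL}_2(\mathbb{R})^2$ with probabilities $(\frac12,\frac12)$ defines a random Bernoulli cocycle over the two-sided full shift $T$ on $\{1,2\}^{\mathbb{Z}}$ with the product measure $(\frac12,\frac12)^{\mathbb{Z}}$, by $A(x)=A_{x_0}$. Its iterates are $A^{(n)}(x)=A(T^{n-1}x)\cdots A(Tx)A(x)$ and its Lyapunov exponent is the almost sure limit $L(A)=\lim_{n\to\infty}\frac1n\log\|A^{(n)}(x)\|$. The probabilities are fixed and the matrices vary; the distance between two cocycles is the uniform one, $\max_i\|A_i-B_i\|$. Moduli of continuity. A function $f$ on a metric space $(Y,d)$ has modulus of continuity $\omega$ if $|f(x)-f(y)|\le\omega(d(x,y))$ for all $x,y\in Y$ (the formulas below being relevant for small $r>0$). The function $f$ is: - Hölder continuous if it has modulus $\omega(r)=C\,r^{\alpha}$ for some $C<\infty$, $0<\alpha\le1$; - weak-Hölder continuous if it has modulus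 $\omega(r)=C\,e^{-\alpha(\log\frac1r)^{\theta}}$ for some $C<\infty$, $0<\alpha\le1$, $0<\theta\le1$; - $(\gamma,\beta)$-log-Hölder continuous ($\gamma\ge1$, $\beta\ge1$) if it has modulus $\omega(r)=C\,e^{-\beta(\log\log\frac1r)^{\gamma}}$ for some $C<\infty$. Each of these properties is said to hold at a point $x_0$ if it holds on some (sufficiently small) neighborhood of $x_0$. *)

theory Defs
  imports "HOL-Probability.Probability"
begin

type_synonym mat2 = "real^2^2"

definition SL2 :: "mat2 set" where
  "SL2 = {M. det M = 1}"

definition mat_norm :: "mat2 \<Rightarrow> real" where
  "mat_norm M = onorm ((*v) M)"

text \<open>
  A pair \<open>A = (A1, A2)\<close> stands for the random Bernoulli cocycle that it generates with the
  fixed probabilities (1/2, 1/2).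
\<close>

type_synonym cocycle = "mat2 \<times> mat2"

definition cocycles :: "cocycle set" where
  "cocycles = SL2 \<times> SL2"

definition cocycle_dist :: "cocycle \<Rightarrow> cocycle \<Rightarrow> real" where
  "cocycle_dist A B = max (mat_norm (fst A - fst B)) (mat_norm (snd A - snd B))"

definition bernoulli_shift_measure :: "(int \<Rightarrow> nat) measure" where
  "bernoulli_shift_measure = (\<Pi>\<^sub>M k\<in>UNIV. uniform_count_measure {1, 2})"

definition shift :: "(int \<Rightarrow> nat) \<Rightarrow> (int \<Rightarrow> nat)" where
  "shift x = (\<lambda>k. x (k + 1))"

text \<open>Symbols other than 1 and 2 do not occur in the space of the Bernoulli measure.\<close>

definition cocycle_map :: "cocycle \<Rightarrow> (int \<Rightarrow> nat) \<Rightarrow> mat2" where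
  "cocycle_map A x = (if x 0 = 1 then fst A else snd A)"

primrec cocycle_iterate :: "cocycle \<Rightarrow> nat \<Rightarrow> (int \<Rightarrow> nat) \<Rightarrow> mat2" where
  "cocycle_iterate A 0 x = mat 1"
| "cocycle_iterate A (Suc n) x = cocycle_map A ((shift ^^ n) x) ** cocycle_iterate A n x"

definition lyapunov_exponent :: "cocycle \<Rightarrow> real" where
  "lyapunov_exponent A = (THE l. AE x in bernoulli_shift_measure.
     (\<lambda>n. 1 / real n * ln (mat_norm (cocycle_iterate A n x))) \<longlonglongrightarrow> l)"

lemma prob_space_bernoulli_shift_measure: "prob_space bernoulli_shift_measure"
  unfolding bernoulli_shift_measure_def
  by (intro prob_space_PiM prob_space_uniform_count_measure) auto

lemma space_bernoulli_shift_measure: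
  "space bernoulli_shift_measure = {x. \<forall>k. x k \<in> {1, 2}}"
  by (auto simp: bernoulli_shift_measure_def space_PiM space_uniform_count_measure PiE_def Pi_def)

lemma lyapunov_exponent_eqI:
  assumes "AE x in bernoulli_shift_measure.
     (\<lambda>n. 1 / real n * ln (mat_norm (cocycle_iterate A n x))) \<longlonglongrightarrow> l"
  shows "lyapunov_exponent A = l"
proof -
  interpret prob_space bernoulli_shift_measure
    by (rule prob_space_bernoulli_shift_measure)
  show ?thesis
    unfolding lyapunov_exponent_def
  proof (rule the_equality)
    fix l'
    assume "AE x in bernoulli_shift_measure.
      (\<lambda>n. 1 / real n * ln (mat_norm (cocycle_iterate A n x))) \<longlonglongrightarrow> l'"
    with assms have "AE x in bernoulli_shift_measure. l' = l"
      by eventually_elim (rule LIMSEQ_unique)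
    then show "l' = l" by simp
  qed (rule assms)
qed

text \<open>
  Moduli of continuity on a set \<open>Y\<close> with distance \<open>d\<close>. At distance 0 the condition is void for a
  modulus that tends to 0 at 0, and the formulas below are meaningful only for small \<open>r > 0\<close>;
  hence the restriction to distinct points.
\<close>

definition has_modulus_on :: "'a set \<Rightarrow> ('a \<Rightarrow> 'a \<Rightarrow> real) \<Rightarrow> ('a \<Rightarrow> real) \<Rightarrow> (real \<Rightarrow> real) \<Rightarrow> bool" where
  "has_modulus_on Y d f \<omega> \<longleftrightarrow> (\<forall>x\<in>Y. \<forall>y\<in>Y. x \<noteq> y \<longrightarrow> \<bar>f x - f y\<bar> \<le> \<omega> (d x y))"

definition Holder_on :: "'a set \<Rightarrow> ('a \<Rightarrow> 'a \<Rightarrow> real) \<Rightarrow> ('a \<Rightarrow> real) \<Rightarrow> bool" where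
  "Holder_on Y d f \<longleftrightarrow>
     (\<exists>C \<alpha>. 0 < \<alpha> \<and> \<alpha> \<le> 1 \<and> has_modulus_on Y d f (\<lambda>r. C * r powr \<alpha>))"

definition weak_Holder_on :: "'a set \<Rightarrow> ('a \<Rightarrow> 'a \<Rightarrow> real) \<Rightarrow> ('a \<Rightarrow> real) \<Rightarrow> bool" where
  "weak_Holder_on Y d f \<longleftrightarrow>
     (\<exists>C \<alpha> \<theta>. 0 < \<alpha> \<and> \<alpha> \<le> 1 \<and> 0 < \<theta> \<and> \<theta> \<le> 1 \<and>
        has_modulus_on Y d f (\<lambda>r. C * exp (- \<alpha> * (ln (1 / r)) powr \<theta>)))"

definition log_Holder_on ::
  "real \<Rightarrow> real \<Rightarrow> 'a set \<Rightarrow> ('a \<Rightarrow> 'a \<Rightarrow> real) \<Rightarrow> ('a \<Rightarrow> real) \<Rightarrow> bool" where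
  "log_Holder_on \<gamma> \<beta> Y d f \<longleftrightarrow>
     (\<exists>C. has_modulus_on Y d f (\<lambda>r. C * exp (- \<beta> * (ln (ln (1 / r))) powr \<gamma>)))"

text \<open>
  A property of functions on metric spaces holds at \<open>x0\<close> if it holds on some ball of \<open>Y\<close> around
  \<open>x0\<close>. The three properties above pass to subsets, so the radius may be taken so small that
  \<open>ln (ln (1 / r)) > 0\<close> for all distances \<open>r > 0\<close> that occur.
\<close>

definition holds_at ::
  "('a set \<Rightarrow> ('a \<Rightarrow> 'a \<Rightarrow> real) \<Rightarrow> ('a \<Rightarrow> real) \<Rightarrow> bool) \<Rightarrow>
   'a set \<Rightarrow> ('a \<Rightarrow> 'a \<Rightarrow> real) \<Rightarrow> ('a \<Rightarrow> real) \<Rightarrow> 'a \<Rightarrow> bool" where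
  "holds_at P Y d f x0 \<longleftrightarrow> (\<exists>\<epsilon>>0. P {x\<in>Y. d x0 x < \<epsilon>} d f)"

definition C_mat :: mat2 where
  "C_mat = vector [vector [0, -1], vector [1, 0]]"

definition D_mat :: mat2 where
  "D_mat = vector [vector [exp 1, 0], vector [0, exp (-1)]]"

lemma C_D_in_cocycles: "(C_mat, D_mat) \<in> cocycles"
  by (simp add: cocycles_def SL2_def C_mat_def D_mat_def det_2 exp_minus)

end

theory Submission
  imports Defs
begin

text \<open>
  The Lyapunov exponent vanishes at \<open>(C, D)\<close>: in coordinates \<open>C\<close> swaps the axes and \<open>D\<close> moves the logarithm
  of the norm by one, so \<open>log \<parallel>A\<^sup>n\<parallel>\<close> is of order \<open>\<surd>n\<close>. Replace \<open>C\<close> by its conjugate \<open>C\<^sub>t\<close> under a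
  unipotent matrix with entry \<open>t = exp (1 - 2 J)\<close>. Then \<open>C\<^sub>t\<^sup>2 = -1\<close> still holds, and the averaging
  operator \<open>P F = (F \<circ> C\<^sub>t + F \<circ> D) / 2\<close> on even functions in \<open>L\<^sup>2(\<real>\<^sup>2)\<close> satisfies
  \<open>\<parallel>P\<^sup>2 F\<parallel>\<^sup>2 \<le> (1 - c / J\<^sup>2) \<parallel>F\<parallel>\<^sup>2\<close>: a function almost invariant under \<open>D\<^sup>2\<close> has little mass in the
  sector \<open>t \<bar>y\<bar> \<le> \<bar>x\<bar> < e\<^sup>2 \<bar>y\<bar> / t\<close>, which has many disjoint translates of width \<open>O(J)\<close>, while \<open>D C\<^sub>t\<close>
  moves the remaining mass near the two axes into that sector in at most two steps. Testing the operator
  on a disc gives \<open>E \<parallel>A\<^sup>n\<parallel>\<^sup>-\<^sup>2 \<le> exp (- c' n / J\<^sup>2)\<close>, so by Jensen the exponent at \<open>(C\<^sub>t, D)\<close> is at least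
  \<open>c'' / J\<^sup>2\<close>, a power of \<open>1 / log (1/t)\<close>. Every modulus in question is smaller than all such powers.
\<close>

section \<open>Finite words and the Bernoulli measure\<close>

abbreviation "\<mu> \<equiv> bernoulli_shift_measure"

definition words :: "nat \<Rightarrow> nat list set" where
  "words n = {w. length w = n \<and> set w \<subseteq> {1, 2}}"

text \<open>Expectation of \<open>f\<close> over the first \<open>n\<close> symbols, kept as a
  finite sum so that conditioning on the first letter becomes a recursion in
  \<open>n\<close>.\<close>

definition word_avg :: "nat \<Rightarrow> (nat list \<Rightarrow> real) \<Rightarrow> real" where
  "word_avg n f = (\<Sum>w\<in>words n. f w) / 2 ^ n"

definition word :: "nat \<Rightarrow> (int \<Rightarrow> nat) \<Rightarrow> nat list" where
  "word n x = map (\<lambda>k. x (int k)) [0..<n]"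

lemma words_0 [simp]: "words 0 = {[]}"
  by (auto simp: words_def)

lemma words_Suc: "words (Suc n) = (#) 1 ` words n \<union> (#) 2 ` words n"
  by (auto simp: words_def length_Suc_conv)

lemma finite_words [simp]: "finite (words n)"
  by (induction n) (auto simp: words_Suc)

lemma word_avg_0 [simp]: "word_avg 0 f = f []"
  by (simp add: word_avg_def)

lemma word_avg_Suc:
  "word_avg (Suc n) f = (word_avg n (\<lambda>w. f (1 # w)) + word_avg n (\<lambda>w. f (2 # w))) / 2"
proof -
  have "(\<Sum>w\<in>words (Suc n). f w) = (\<Sum>w\<in>words n. f (1 # w)) + (\<Sum>w\<in>words n. f (2 # w))"
    unfolding words_Suc by (subst sum.union_disjoint) (auto simp: sum.reindex)
  then show ?thesis by (simp add: word_avg_def field_simps)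
qed

lemma word_avg_const [simp]: "word_avg n (\<lambda>_. c) = c"
  by (induction n) (simp_all add: word_avg_Suc)

lemma word_avg_add: "word_avg n (\<lambda>w. f w + g w) = word_avg n f + word_avg n g"
  by (simp add: word_avg_def sum.distrib add_divide_distrib)

lemma word_avg_mult: "word_avg n (\<lambda>w. c * f w) = c * word_avg n f"
  by (simp add: word_avg_def sum_distrib_left)

lemma word_avg_mult_right: "word_avg n (\<lambda>w. g w * c) = word_avg n g * c"
  by (simp add: word_avg_def sum_distrib_right)

lemma word_avg_mono: "(\<And>w. w \<in> words n \<Longrightarrow> f w \<le> g w) \<Longrightarrow> word_avg n f \<le> word_avg n g"
  unfolding word_avg_def by (intro divide_right_mono sum_mono) auto

lemma word_avg_append:
  "word_avg (n + m) f = word_avg n (\<lambda>u. word_avg m (\<lambda>w. f (u @ w)))"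
  by (induction n arbitrary: f) (simp_all add: word_avg_Suc)

section \<open>The law of initial words under the Bernoulli measure\<close>

lemma measurable_coordinate [measurable]: "(\<lambda>x. x k) \<in> \<mu> \<rightarrow>\<^sub>M count_space UNIV"
proof -
  have "(\<lambda>x. x k) \<in> \<mu> \<rightarrow>\<^sub>M uniform_count_measure {1, 2}"
    unfolding bernoulli_shift_measure_def by (rule measurable_component_singleton) auto
  moreover have "(\<lambda>x. x) \<in> uniform_count_measure {1, 2 :: nat} \<rightarrow>\<^sub>M count_space UNIV"
    by (auto simp: measurable_def sets_uniform_count_measure space_uniform_count_measure)
  ultimately show ?thesis by (rule measurable_compose)
qed

text \<open>There are only countably many words, so it is enough that each cylinder set is
  measurable.\<close>

lemma measurable_word [measurable]: "word n \<in> \<mu> \<rightarrow>\<^sub>M count_space UNIV"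
proof -
  have *: "word n -` {w} \<inter> space \<mu> \<in> sets \<mu>" for w
  proof (cases "length w = n")
    case True
    have "word n x = w \<longleftrightarrow> (\<forall>k\<in>{..<n}. x (int k) = w ! k)" for x
      using True by (auto simp: word_def list_eq_iff_nth_eq)
    then have "word n -` {w} \<inter> space \<mu> = {x \<in> space \<mu>. \<forall>k\<in>{..<n}. x (int k) = w ! k}"
      by blast
    also have "\<dots> \<in> sets \<mu>" by measurable
    finally show ?thesis .
  next
    case False
    then have "word n -` {w} \<inter> space \<mu> = {}" by (auto simp: word_def)
    then show ?thesis by simp
  qed
  then show ?thesis
    by (simp add: measurable_count_space_eq_countable)
qed

lemma word_in_words: "x \<in> space \<mu> \<Longrightarrow> word n x \<in> words n"
proof -
  assume "x \<in> space \<mu>"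
  then have "x k \<in> {1, 2}" for k unfolding space_bernoulli_shift_measure by blast
  then have "set (word n x) \<subseteq> {1, 2}" unfolding word_def by (simp only: set_map) blast
  then show ?thesis by (simp add: words_def word_def)
qed

lemma word_Suc: "word (Suc n) x = x 0 # word n (shift x)"
proof -
  have "word (Suc n) x = x 0 # map (\<lambda>k. x (int k)) [Suc 0..<Suc n]"
    unfolding word_def by (subst upt_conv_Cons) auto
  also have "map (\<lambda>k. x (int k)) [Suc 0..<Suc n] = word n (shift x)"
    by (simp add: word_def shift_def map_Suc_upt [symmetric] ac_simps del: upt_Suc)
  finally show ?thesis .
qed

lemma shift_funpow: "(shift ^^ n) x = (\<lambda>k. x (k + int n))"
  by (induction n arbitrary: x) (auto simp: shift_def fun_eq_iff ac_simps)

lemma word_append: "word (n + m) x = word n x @ word m ((shift ^^ n) x)"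
  by (induction n arbitrary: x) (simp_all add: word_Suc funpow_swap1 word_def[of 0])

text \<open>A word fixes \<open>n\<close> independent coordinates, each of which has its prescribed
  value with probability 1/2.\<close>

lemma measure_word:
  assumes "w \<in> words n"
  shows "measure \<mu> (word n -` {w} \<inter> space \<mu>) = 1 / 2 ^ n"
proof -
  interpret P: product_prob_space "\<lambda>_::int. uniform_count_measure {1, 2 :: nat}" UNIV
    by (intro product_prob_spaceI prob_space_uniform_count_measure) auto
  have len: "length w = n" and set: "set w \<subseteq> {1, 2}" using assms by (auto simp: words_def)
  let ?J = "int ` {..<n}" and ?X = "\<lambda>i. {w ! nat i}"
  have w: "w ! k \<in> {1, 2}" if "k < n" for k
    using subsetD [OF set nth_mem [of k w]] that len by blast
  have eq: "word n -` {w} \<inter> space \<mu> = {x \<in> space \<mu>. \<forall>i\<in>?J. x i \<in> ?X i}"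
  proof -
    have "word n x = w \<longleftrightarrow> (\<forall>i\<in>?J. x i \<in> ?X i)" for x
      by (auto simp: word_def list_eq_iff_nth_eq len)
    then show ?thesis by blast
  qed
  have X: "?X i \<in> sets (uniform_count_measure {1, 2})" if i: "i \<in> ?J" for i
  proof -
    obtain k where "k < n" "i = int k" using i by auto
    with w[of k] show ?thesis by (simp add: sets_uniform_count_measure)
  qed
  have "emeasure \<mu> {x \<in> space \<mu>. \<forall>i\<in>?J. x i \<in> ?X i}
      = (\<Prod>i\<in>?J. emeasure (uniform_count_measure {1, 2}) (?X i))"
    using P.emeasure_PiM_Collect [of ?J ?X, OF subset_UNIV _ X]
    unfolding bernoulli_shift_measure_def by blast
  also have "\<dots> = (\<Prod>i\<in>?J. ennreal (1 / 2))"
  proof (intro prod.cong refl)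
    fix i assume "i \<in> ?J"
    then obtain k where "k < n" "i = int k" by blast
    then have "?X i \<subseteq> {1, 2}" using w[of k] by simp
    then show "emeasure (uniform_count_measure {1, 2}) (?X i) = ennreal (1 / 2)"
      by (subst emeasure_uniform_count_measure) simp_all
  qed
  also have "\<dots> = ennreal ((1 / 2) ^ n)"
    by (simp only: prod_constant card_image [OF inj_on_of_nat] card_lessThan) (rule ennreal_power, simp)
  finally have "emeasure \<mu> (word n -` {w} \<inter> space \<mu>) = ennreal ((1 / 2) ^ n)"
    unfolding eq .
  then show ?thesis unfolding measure_def by (simp only: enn2real_ennreal zero_le_power zero_le_divide_1_iff zero_le_numeral power_one_over)
qed

text \<open>A function of the initial word is a finite linear combination of indicators of
  cylinders, all of equal measure.\<close>

lemma integral_word: "(\<integral>x. f (word n x) \<partial>\<mu>) = word_avg n f"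
  and integrable_word: "integrable \<mu> (\<lambda>x. f (word n x) :: real)"
proof -
  interpret prob_space \<mu> by (rule prob_space_bernoulli_shift_measure)
  let ?S = "\<lambda>w. word n -` {w} \<inter> space \<mu>"
  have meas: "?S w \<in> sets \<mu>" for w
    by (rule measurable_sets [OF measurable_word]) auto
  have eq: "f (word n x) = (\<Sum>w\<in>words n. f w * indicator (?S w) x)" if "x \<in> space \<mu>" for x
  proof -
    have "(\<Sum>w\<in>words n. f w * indicator (?S w) x) = (\<Sum>w\<in>words n. if word n x = w then f w else 0)"
      using that by (intro sum.cong) (auto simp: indicator_def)
    also have "\<dots> = f (word n x)" using word_in_words[OF that] by simp
    finally show ?thesis by simp
  qed
  have int: "integrable \<mu> (\<lambda>x. f w * indicator (?S w) x)" for w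
    using meas by (intro integrable_mult_right integrable_real_indicator) (auto simp: emeasure_eq_measure)
  show "integrable \<mu> (\<lambda>x. f (word n x))"
    by (subst Bochner_Integration.integrable_cong[OF refl eq])
      (assumption, rule Bochner_Integration.integrable_sum, rule int)
  have "(\<integral>x. f (word n x) \<partial>\<mu>) = (\<integral>x. (\<Sum>w\<in>words n. f w * indicator (?S w) x) \<partial>\<mu>)"
    by (rule Bochner_Integration.integral_cong[OF refl eq])
  also have "\<dots> = (\<Sum>w\<in>words n. f w * measure \<mu> (?S w))"
    by (subst Bochner_Integration.integral_sum) (rule int, simp)
  also have "\<dots> = word_avg n f"
    unfolding word_avg_def sum_divide_distrib by (intro sum.cong refl) (simp only: measure_word times_divide_eq_right mult_1_right)
  finally show "(\<integral>x. f (word n x) \<partial>\<mu>) = word_avg n f" .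
qed

section \<open>Shift invariance\<close>

lemma shift_distr: "distr \<mu> \<mu> shift = \<mu>"
proof -
  have "distr \<mu> \<mu> (\<lambda>\<omega>. \<lambda>n\<in>UNIV. \<omega> (n + 1)) = \<mu>"
    unfolding bernoulli_shift_measure_def
    by (rule distr_PiM_reindex) (auto intro: prob_space_uniform_count_measure simp: inj_on_def)
  moreover have "shift = (\<lambda>\<omega>. \<lambda>n\<in>UNIV. \<omega> (n + 1))" by (simp add: shift_def fun_eq_iff)
  ultimately show ?thesis by simp
qed

lemma measurable_shift [measurable]: "shift \<in> \<mu> \<rightarrow>\<^sub>M \<mu>"
  unfolding bernoulli_shift_measure_def shift_def
  by (rule measurable_PiM_single') (auto simp: space_PiM PiE_def)

lemma measurable_shift_funpow [measurable]: "shift ^^ n \<in> \<mu> \<rightarrow>\<^sub>M \<mu>"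
  by (induction n) (auto simp: id_def[symmetric] intro: measurable_comp)

lemma integral_shift_funpow:
  fixes f :: "_ \<Rightarrow> real"
  assumes [measurable]: "f \<in> borel_measurable \<mu>"
  shows "(\<integral>x. f ((shift ^^ n) x) \<partial>\<mu>) = (\<integral>x. f x \<partial>\<mu>)"
proof -
  have "distr \<mu> \<mu> (shift ^^ n) = \<mu>"
  proof (induction n)
    case 0
    then show ?case by (simp add: id_def distr_id)
  next
    case (Suc n)
    have "distr \<mu> \<mu> (shift ^^ Suc n) = distr (distr \<mu> \<mu> (shift ^^ n)) \<mu> shift"
      by (subst distr_distr) (auto simp: funpow_swap1)
    then show ?case by (simp only: Suc shift_distr)
  qed
  then show ?thesis by (metis assms integral_distr measurable_shift_funpow)
qed

lemma measure_word_event: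
  "measure \<mu> {x \<in> space \<mu>. P (word n x)} = word_avg n (\<lambda>w. of_bool (P w))"
proof -
  have "measure \<mu> {x \<in> space \<mu>. P (word n x)} = (\<integral>x. indicator {x \<in> space \<mu>. P (word n x)} x \<partial>\<mu>)"
    by (simp add: Int_absorb1)
  also have "\<dots> = (\<integral>x. of_bool (P (word n x)) \<partial>\<mu>)"
    by (intro Bochner_Integration.integral_cong) (auto simp: indicator_def)
  also have "\<dots> = word_avg n (\<lambda>w. of_bool (P w))"
    by (rule integral_word)
  finally show ?thesis .
qed

lemma integrable_bounded:
  assumes "g \<in> borel_measurable \<mu>" "\<And>x. \<bar>g x\<bar> \<le> (B :: real)"
  shows "integrable \<mu> g"
proof -
  interpret prob_space \<mu> by (rule prob_space_bernoulli_shift_measure)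
  show ?thesis using assms by (intro integrable_const_bound[of _ B]) auto
qed

section \<open>A subadditive ergodic theorem for Bernoulli words\<close>

text \<open>The abstract form of \<open>w\<close> mapped to the logarithm of the norm of its matrix
  product. \<open>tail_le\<close> says that deleting the first letter costs at most
  \<open>K\<close>; for matrices this comes from the norm of the inverse letter.\<close>

locale subadditive_on_words =
  fixes f :: "nat list \<Rightarrow> real" and K :: real
  assumes nonneg: "0 \<le> f w"
    and Nil: "f [] = 0"
    and append: "f (u @ w) \<le> f u + f w"
    and letter_le: "f [a] \<le> K"
    and tail_le: "f w \<le> f (a # w) + K"
begin

text \<open>By Fekete's lemma this infimum is also the limit of the averages; as an infimum it is
  bounded by any single length.\<close>

definition growth :: real where
  "growth = (INF n\<in>{1..}. word_avg n f / real n)"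

text \<open>The quotients lie between 0 and \<open>K\<close>, so the liminf is finite and its
  conversion to a real number loses nothing.\<close>

definition lower_rate :: "(int \<Rightarrow> nat) \<Rightarrow> real" where
  "lower_rate x = real_of_ereal (liminf (\<lambda>n. ereal (f (word n x) / real n)))"

lemma K_nonneg: "0 \<le> K"
  using nonneg[of "[a]"] letter_le[of a] by linarith

lemma le_length: "f w \<le> K * real (length w)"
proof (induction w)
  case (Cons a w)
  have "f (a # w) \<le> f [a] + f w" using append[of "[a]" w] by simp
  with Cons letter_le[of a] show ?case by (simp add: algebra_simps)
qed (simp add: Nil)

lemma le_word: "f (word n x) \<le> K * real n"
  using le_length[of "word n x"] by (simp add: word_def)

lemma growth_le: "n \<ge> 1 \<Longrightarrow> growth \<le> word_avg n f / real n"
  unfolding growth_def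
  by (intro cINF_lower bdd_belowI2[of _ 0]) (auto simp: word_avg_def nonneg intro!: divide_nonneg_nonneg sum_nonneg)

lemma measurable_f [measurable]: "(\<lambda>x. f (word n x)) \<in> borel_measurable \<mu>"
  by (rule measurable_compose [OF measurable_word]) simp

text \<open>At \<open>s = 0\<close> the moment equals 1 and its derivative in \<open>s\<close> is
  \<open>word_avg M f - b\<close>, which is negative. Hence it drops below 1 for small positive
  \<open>s\<close>.\<close>

lemma exp_moment:
  assumes "word_avg M f < b"
  obtains s where "s > 0" "word_avg M (\<lambda>w. exp (s * (f w - b))) < 1"
proof -
  let ?h = "\<lambda>s. word_avg M (\<lambda>w. exp (s * (f w - b)))"
  have "(?h has_real_derivative (\<Sum>w\<in>words M. exp (0 * (f w - b)) * (f w - b)) / 2 ^ M) (at 0)"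
    unfolding word_avg_def by (auto intro!: derivative_eq_intros)
  moreover have "(\<Sum>w\<in>words M. exp (0 * (f w - b)) * (f w - b)) / 2 ^ M = word_avg M f - b"
    using word_avg_add[of M f "\<lambda>_. - b"] by (simp add: word_avg_def)
  ultimately have "(?h has_real_derivative (word_avg M f - b)) (at 0)" by simp
  from DERIV_neg_dec_right [OF this] assms
  obtain d where "d > 0" and d: "\<And>h. h > 0 \<Longrightarrow> h < d \<Longrightarrow> ?h (0 + h) < ?h 0" by auto
  have "?h (d / 2) < 1" using d[of "d / 2"] \<open>d > 0\<close> by simp
  with \<open>d > 0\<close> show thesis by (intro that[of "d / 2"]) auto
qed

text \<open>Subadditivity bounds the exponential of the sum by a product over blocks of length
  \<open>M\<close>, and the blocks are independent.\<close>

lemma exp_moment_power: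
  assumes "s > 0"
  shows "word_avg (k * M) (\<lambda>w. exp (s * (f w - real k * b)))
    \<le> word_avg M (\<lambda>w. exp (s * (f w - b))) ^ k"
proof (induction k)
  case 0
  then show ?case by (simp add: Nil)
next
  case (Suc k)
  let ?r = "word_avg M (\<lambda>w. exp (s * (f w - b)))"
  have "word_avg (Suc k * M) (\<lambda>w. exp (s * (f w - real (Suc k) * b)))
     = word_avg M (\<lambda>u. word_avg (k * M) (\<lambda>w. exp (s * (f (u @ w) - real (Suc k) * b))))"
    using word_avg_append[of M "k * M"] by simp
  also have "\<dots> \<le> word_avg M (\<lambda>u. word_avg (k * M) (\<lambda>w. exp (s * (f u - b)) * exp (s * (f w - real k * b))))"
  proof (intro word_avg_mono)
    fix u w
    have "s * (f (u @ w) - real (Suc k) * b) \<le> s * ((f u - b) + (f w - real k * b))"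
      using \<open>s > 0\<close> append[of u w] by (intro mult_left_mono) (auto simp: algebra_simps)
    then show "exp (s * (f (u @ w) - real (Suc k) * b)) \<le> exp (s * (f u - b)) * exp (s * (f w - real k * b))"
      by (simp add: exp_add [symmetric] algebra_simps)
  qed
  also have "\<dots> = word_avg (k * M) (\<lambda>w. exp (s * (f w - real k * b))) * ?r"
    unfolding word_avg_mult word_avg_mult_right by (rule mult.commute)
  also have "\<dots> \<le> ?r ^ k * ?r"
    by (intro mult_right_mono Suc.IH) (auto simp: word_avg_def intro!: divide_nonneg_nonneg sum_nonneg)
  finally show ?case by (simp add: mult.commute)
qed

text \<open>
  Exponential moments of words of length \<open>k M\<close> decay geometrically in \<open>k\<close> by subadditivity, so no law of
  large numbers is needed.
\<close>

lemma AE_upper: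
  assumes "c > growth"
  shows "AE x in \<mu>. eventually (\<lambda>n. f (word n x) \<le> c * real n) sequentially"
proof -
  interpret prob_space \<mu> by (rule prob_space_bernoulli_shift_measure)
  obtain M where M: "M \<ge> 1" "word_avg M f / real M < c"
  proof -
    have "\<exists>M\<in>{1..}. word_avg M f / real M < c"
      using assms unfolding growth_def by (subst (asm) cINF_less_iff)
        (auto intro!: bdd_belowI2[of _ 0] divide_nonneg_nonneg sum_nonneg simp: word_avg_def nonneg)
    then show thesis using that by auto
  qed
  \<comment> \<open>Midway between the mean of a block and \<open>c * real M\<close>: above the
    mean, so that the moment decays, and below \<open>c * real M\<close>, so that there is room for
    an incomplete last block.\<close>
  define b where "b = (word_avg M f + c * real M) / 2"
  have b: "word_avg M f < b" "b < c * real M" using M by (auto simp: b_def field_simps)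
  obtain s where s: "s > 0" "word_avg M (\<lambda>w. exp (s * (f w - b))) < 1" using exp_moment[OF b(1)] .
  let ?r = "word_avg M (\<lambda>w. exp (s * (f w - b)))"
  let ?A = "\<lambda>k. {x \<in> space \<mu>. f (word (k * M) x) \<ge> real k * b}"
  have r0: "?r \<ge> 0" by (auto simp: word_avg_def intro!: divide_nonneg_nonneg sum_nonneg)
  have A: "measure \<mu> (?A k) \<le> ?r ^ k" for k
  proof -
    have "measure \<mu> (?A k) = word_avg (k * M) (\<lambda>w. of_bool (f w \<ge> real k * b))"
      by (rule measure_word_event)
    \<comment> \<open>Markov's inequality in exponential form: on the event the exponent is
      nonnegative.\<close>
    also have "\<dots> \<le> word_avg (k * M) (\<lambda>w. exp (s * (f w - real k * b)))"
      using s(1) by (intro word_avg_mono) auto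
    also have "\<dots> \<le> ?r ^ k" by (rule exp_moment_power) fact
    finally show ?thesis .
  qed
  have "AE x in \<mu>. eventually (\<lambda>k. x \<in> space \<mu> - ?A k) sequentially"
  proof (rule borel_cantelli_AE1)
    show "summable (\<lambda>k. measure \<mu> (?A k))"
      using A s(2) r0 by (intro summable_comparison_test'[OF summable_geometric[of ?r], of 0]) auto
  qed (auto simp: emeasure_eq_measure)
  then show ?thesis
  proof (rule AE_mp, intro AE_I2 impI)
    fix x assume "x \<in> space \<mu>" "eventually (\<lambda>k. x \<in> space \<mu> - ?A k) sequentially"
    then obtain k0 where k0: "\<And>k. k \<ge> k0 \<Longrightarrow> f (word (k * M) x) < real k * b"
      by (auto simp: eventually_sequentially not_le)
    have "0 < real k0 * b" using k0[of k0] nonneg[of "word (k0 * M) x"] by linarith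
    then have "b > 0" by (simp add: zero_less_mult_iff)
    have bM: "b / real M < c" using b(2) M by (simp add: field_simps)
    \<comment> \<open>From here on the slack \<open>(c - b / real M) * real n\<close> pays for the
      last incomplete block, whose cost is at most \<open>K * real M\<close>.\<close>
    obtain n0 :: nat where n0: "real n0 > K * real M / (c - b / real M)"
      using reals_Archimedean2 by blast
    have "f (word n x) \<le> c * real n" if n: "n \<ge> max n0 (k0 * M)" for n
    proof -
      let ?k = "n div M"
      have nk: "n = ?k * M + n mod M" by simp
      have "?k \<ge> k0" using n M(1) by (simp add: less_eq_div_iff_mult_less_eq)
      have "f (word n x) \<le> f (word (?k * M) x) + f (word (n mod M) ((shift ^^ (?k * M)) x))"
        by (subst nk, subst word_append) (rule append)
      also have "f (word (?k * M) x) \<le> real ?k * b" using k0[OF \<open>?k \<ge> k0\<close>] by simp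
      also have "f (word (n mod M) ((shift ^^ (?k * M)) x)) \<le> K * real (n mod M)" by (rule le_word)
      also have "\<dots> \<le> K * real M" using K_nonneg M(1)
        by (intro mult_left_mono) (auto intro: less_imp_le mod_less_divisor)
      also have "real ?k * b \<le> real n / real M * b"
        using \<open>b > 0\<close> by (intro mult_right_mono) (auto simp: of_nat_div_le_of_nat)
      also have "K * real M \<le> (c - b / real M) * real n"
      proof -
        have "K * real M / (c - b / real M) \<le> real n" using n0 n by simp
        then show ?thesis using bM by (simp add: pos_divide_le_eq mult.commute)
      qed
      finally show ?thesis by (simp add: algebra_simps)
    qed
    then show "eventually (\<lambda>n. f (word n x) \<le> c * real n) sequentially"
      unfolding eventually_sequentially by blast
  qed
qed

section \<open>The lower growth rate along an orbit\<close>

lemma liminf_bounds: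
  "0 \<le> liminf (\<lambda>n. ereal (f (word n x) / real n))"
  "liminf (\<lambda>n. ereal (f (word n x) / real n)) \<le> ereal K"
proof -
  show "0 \<le> liminf (\<lambda>n. ereal (f (word n x) / real n))"
    by (intro Liminf_bounded always_eventually) (simp add: nonneg)
  have "f (word n x) / real n \<le> K" for n
    using le_word[of n x] K_nonneg by (cases "n = 0") (auto simp: field_simps)
  then show "liminf (\<lambda>n. ereal (f (word n x) / real n)) \<le> ereal K"
    by (intro Liminf_le) auto
qed

lemma ereal_lower_rate:
  "ereal (lower_rate x) = liminf (\<lambda>n. ereal (f (word n x) / real n))"
  using liminf_bounds[of x] unfolding lower_rate_def by (intro ereal_real') auto

lemma lower_rate_bounds: "0 \<le> lower_rate x" "lower_rate x \<le> K"
  using liminf_bounds[of x] unfolding ereal_lower_rate [symmetric] by auto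

lemma measurable_lower_rate [measurable]: "lower_rate \<in> borel_measurable \<mu>"
  unfolding lower_rate_def [abs_def] by measurable

lemma eventually_lower_rate:
  assumes "y < lower_rate x"
  shows "eventually (\<lambda>n. y < f (word n x) / real n) sequentially"
  using less_LiminfD[of "ereal y" sequentially "\<lambda>n. ereal (f (word n x) / real n)"] assms by (simp add: ereal_lower_rate [symmetric])

lemma lower_rate_geI:
  assumes "eventually (\<lambda>n. y \<le> f (word n x) / real n) sequentially"
  shows "y \<le> lower_rate x"
  using Liminf_bounded[where C = "ereal y" and F = sequentially and X = "\<lambda>n. ereal (f (word n x) / real n)"] assms
  by (simp add: ereal_lower_rate [symmetric])

text \<open>By \<open>tail_le\<close>, \<open>f\<close> of the tail exceeds \<open>f\<close> of the
  whole word by at most \<open>K\<close>, which disappears after division by the length.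
  Monotonicity along the orbit is what the greedy decomposition below uses.\<close>

lemma lower_rate_shift: "lower_rate (shift x) \<le> lower_rate x"
proof (rule dense_le)
  fix y' assume "y' < lower_rate (shift x)"
  then obtain y where y: "y' < y" "y < lower_rate (shift x)" using dense by blast
  \<comment> \<open>One \<open>K\<close> pays for the deleted letter, the other for passing from
    \<open>n\<close> to \<open>Suc n\<close>, since \<open>y' < K\<close>.\<close>
  have "eventually (\<lambda>n. real n > 2 * K / (y - y')) sequentially"
    using filterlim_real_sequentially by (simp add: filterlim_at_top_dense)
  with eventually_lower_rate[OF y(2)] eventually_gt_at_top[of 0]
  have "eventually (\<lambda>n. y' \<le> f (word (Suc n) x) / real (Suc n)) sequentially"
  proof eventually_elim
    case (elim n)
    let ?g = "f (word (Suc n) x)"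
    have "y * real n \<le> f (word n (shift x))" using elim by (simp add: field_simps)
    also have "\<dots> \<le> ?g + K" using tail_le by (simp add: word_Suc)
    finally have 1: "y * real n \<le> ?g + K" .
    have "2 * K < (y - y') * real n" using elim y by (simp add: field_simps)
    with 1 have 2: "y' * real n + K \<le> ?g" by (simp add: algebra_simps)
    have "y' < K" using y lower_rate_bounds(2)[of "shift x"] by linarith
    with 2 have "y' * real (Suc n) \<le> ?g" by (simp add: algebra_simps)
    then show ?case by (simp add: field_simps)
  qed
  then show "y' \<le> lower_rate x"
    by (intro lower_rate_geI)
       (subst (asm) eventually_sequentially_Suc[of "\<lambda>n. y' \<le> f (word n x) / real n"])
qed

lemma lower_rate_shift_funpow: "lower_rate ((shift ^^ n) x) \<le> lower_rate x"
proof (induction n)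
  case (Suc n)
  then show ?case using lower_rate_shift[of "(shift ^^ n) x"] by simp
qed simp

lemma ex_near_lower_rate:
  assumes "\<epsilon> > 0"
  shows "\<exists>n\<ge>1. f (word n x) \<le> real n * (lower_rate x + \<epsilon>)"
proof (rule ccontr)
  assume "\<not> ?thesis"
  then have *: "f (word n x) > real n * (lower_rate x + \<epsilon>)" if "n \<ge> 1" for n
    using that by (meson not_le)
  have "lower_rate x + \<epsilon> \<le> lower_rate x"
  proof (rule lower_rate_geI)
    show "eventually (\<lambda>n. lower_rate x + \<epsilon> \<le> f (word n x) / real n) sequentially"
      using eventually_ge_at_top[of 1] by eventually_elim (use * in \<open>force simp: field_simps\<close>)
  qed
  with assms show False by simp
qed

text \<open>The exceptional set: no initial word of length at most \<open>N\<close> comes within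
  \<open>\<epsilon>\<close> of the lower rate. For fixed \<open>\<epsilon>\<close> these sets
  decrease to the empty set as \<open>N\<close> grows.\<close>

definition late :: "real \<Rightarrow> nat \<Rightarrow> (int \<Rightarrow> nat) \<Rightarrow> bool" where
  "late \<epsilon> N x \<longleftrightarrow> (\<forall>n\<in>{1..N}. f (word n x) > real n * (lower_rate x + \<epsilon>))"

text \<open>
  Katznelson and Weiss: cut the orbit segment greedily into pieces along which \<open>f\<close> grows at most at
  the rate \<open>lower_rate x + \<epsilon>\<close>; where no such piece of length at most \<open>N\<close> exists, spend one letter at
  the cost \<open>K\<close>.
\<close>

lemma greedy_bound:
  assumes "\<epsilon> > 0"
  shows "f (word m x) \<le> real m * (lower_rate x + \<epsilon>)
    + K * (\<Sum>i<m. of_bool (late \<epsilon> N ((shift ^^ i) x))) + K * real N"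
proof (induction m arbitrary: x rule: less_induct)
  case (less m)
  let ?b = "\<lambda>x m. \<Sum>i<m. of_bool (late \<epsilon> N ((shift ^^ i) x)) :: real"
  have b0: "?b x m \<ge> 0" for x m by (intro sum_nonneg) auto
  have l0: "lower_rate x + \<epsilon> > 0" using lower_rate_bounds(1)[of x] assms by linarith
  \<comment> \<open>Cut off a first piece of length \<open>n\<close> and apply the induction
    hypothesis to the rest. The rate at \<open>?y\<close> is at most the rate at \<open>x\<close>,
    so a single rate serves for all pieces.\<close>
  have step: "f (word m x) \<le> real m * (lower_rate x + \<epsilon>) + K * ?b x m + K * real N"
    if n: "1 \<le> n" "n \<le> m" and le: "f (word n x) \<le> real n * (lower_rate x + \<epsilon>) + K * ?b x n" for n
  proof -
    let ?y = "(shift ^^ n) x"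
    have "f (word m x) \<le> f (word n x) + f (word (m - n) ?y)"
      using append[of "word n x" "word (m - n) ?y"] word_append[of n "m - n" x] n by simp
    also have "f (word (m - n) ?y) \<le> real (m - n) * (lower_rate ?y + \<epsilon>) + K * ?b ?y (m - n) + K * real N"
      using n by (intro less.IH) auto
    also have "real (m - n) * (lower_rate ?y + \<epsilon>) \<le> real (m - n) * (lower_rate x + \<epsilon>)"
      using lower_rate_shift_funpow[of n x] by (intro mult_left_mono) auto
    also note le
    finally have "f (word m x) \<le> real n * (lower_rate x + \<epsilon>) + real (m - n) * (lower_rate x + \<epsilon>)
        + K * (?b x n + ?b ?y (m - n)) + K * real N"
      by (simp add: algebra_simps)
    also have "?b x n + ?b ?y (m - n) = ?b x m"
    proof -
      have "?b x m = ?b x n + (\<Sum>i\<in>{n..<m}. of_bool (late \<epsilon> N ((shift ^^ i) x)))"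
        unfolding lessThan_atLeast0 using n by (intro sum.atLeastLessThan_concat[symmetric]) auto
      also have "(\<Sum>i\<in>{n..<m}. of_bool (late \<epsilon> N ((shift ^^ i) x))) = ?b ?y (m - n)"
        unfolding sum.atLeastLessThan_shift_0 [of _ n m] comp_def lessThan_atLeast0 add.commute [of n]
        by (simp only: funpow_add comp_apply)
      finally show ?thesis by simp
    qed
    also have "real n * (lower_rate x + \<epsilon>) + real (m - n) * (lower_rate x + \<epsilon>) = real m * (lower_rate x + \<epsilon>)"
      using n by (simp add: of_nat_diff algebra_simps)
    finally show ?thesis .
  qed
  show ?case
  proof (cases "m \<le> N")
    case True
    \<comment> \<open>The final remainder, which may be too short to contain a whole good piece,
      accounts for the additive term \<open>K * real N\<close>.\<close>
    have "f (word m x) \<le> K * real N"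
      using le_word[of m x] mult_left_mono[of "real m" "real N" K] True K_nonneg by simp
    moreover have "0 \<le> real m * (lower_rate x + \<epsilon>)" "0 \<le> K * ?b x m"
      using l0 K_nonneg b0[of x m] by (auto intro: mult_nonneg_nonneg)
    ultimately show ?thesis by linarith
  next
    case False
    show ?thesis
    proof (cases "late \<epsilon> N x")
      case True
      have "f (word 1 x) \<le> K" using le_word[of 1 x] by simp
      moreover have "?b x 1 = 1" using True by simp
      ultimately show ?thesis using False l0 K_nonneg by (intro step[of 1]) simp_all
    next
      case notlate: False
      then obtain n where n: "1 \<le> n" "n \<le> N" "f (word n x) \<le> real n * (lower_rate x + \<epsilon>)"
        by (auto simp: late_def not_less)
      moreover have "0 \<le> K * ?b x n" using K_nonneg b0[of x n] by (intro mult_nonneg_nonneg)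
      ultimately show ?thesis using False by (intro step[of n]) linarith+
    qed
  qed
qed

lemma measurable_late [measurable]: "Measurable.pred \<mu> (late \<epsilon> N)"
  unfolding late_def [abs_def] by measurable

text \<open>Integrate the greedy bound: by shift invariance every \<open>late\<close> term has the
  same probability \<open>?p N\<close>. Divide by \<open>m\<close>, let \<open>m\<close> tend to
  infinity for fixed \<open>N\<close>, then let \<open>N\<close> tend to infinity.\<close>

lemma growth_le_expectation: "growth \<le> (\<integral>x. lower_rate x \<partial>\<mu>)"
proof (rule field_le_epsilon)
  interpret prob_space \<mu> by (rule prob_space_bernoulli_shift_measure)
  fix \<epsilon> :: real assume eps: "\<epsilon> > 0"
  let ?p = "\<lambda>N. measure \<mu> {x \<in> space \<mu>. late \<epsilon> N x}" and ?E = "\<integral>x. lower_rate x \<partial>\<mu>"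
  have il: "integrable \<mu> lower_rate"
    by (rule integrable_bounded[of _ K]) (use lower_rate_bounds in auto)
  have avg: "word_avg m f \<le> real m * (?E + \<epsilon>) + K * (real m * ?p N) + K * real N" for m N
  proof -
    let ?o = "\<lambda>i x. of_bool (late \<epsilon> N ((shift ^^ i) x)) :: real"
    have int: "integrable \<mu> (?o i)" for i
      by (intro integrable_bounded[of _ 1]) (auto intro: measurable_compose[OF measurable_shift_funpow])
    have o: "(\<integral>x. ?o i x \<partial>\<mu>) = ?p N" for i
    proof -
      have "(\<integral>x. ?o i x \<partial>\<mu>) = (\<integral>x. of_bool (late \<epsilon> N x) \<partial>\<mu>)"
        by (intro integral_shift_funpow[of "\<lambda>x. of_bool (late \<epsilon> N x)"]) measurable
      also have "\<dots> = (\<integral>x. indicator {x \<in> space \<mu>. late \<epsilon> N x} x \<partial>\<mu>)"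
        by (intro Bochner_Integration.integral_cong) (auto simp: indicator_def)
      finally show ?thesis by (simp add: Int_absorb1)
    qed
    have "word_avg m f = (\<integral>x. f (word m x) \<partial>\<mu>)" by (rule integral_word[symmetric])
    also have "\<dots> \<le> (\<integral>x. real m * (lower_rate x + \<epsilon>) + K * (\<Sum>i<m. ?o i x) + K * real N \<partial>\<mu>)"
    proof (rule integral_mono)
      show "integrable \<mu> (\<lambda>x. real m * (lower_rate x + \<epsilon>) + K * (\<Sum>i<m. ?o i x) + K * real N)"
        by (intro Bochner_Integration.integrable_add integrable_mult_right Bochner_Integration.integrable_sum
            il int integrable_const)
    qed (rule integrable_word greedy_bound eps)+
    also have "\<dots> = real m * (?E + \<epsilon>) + K * (real m * ?p N) + K * real N"
      using il int by (simp add: o prob_space del: sum_of_bool_eq)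
    finally show ?thesis .
  qed
  have le: "growth \<le> ?E + \<epsilon> + K * ?p N" for N
  proof (rule LIMSEQ_le_const)
    show "(\<lambda>m. ?E + \<epsilon> + K * ?p N + K * real N / real m) \<longlonglongrightarrow> ?E + \<epsilon> + K * ?p N"
      using tendsto_add[OF tendsto_const lim_const_over_n] by fastforce
    have "growth \<le> ?E + \<epsilon> + K * ?p N + K * real N / real m" if "m \<ge> 1" for m
    proof -
      have "growth * real m \<le> word_avg m f" using growth_le[OF that] that by (simp add: field_simps)
      with avg[of m N] have "growth * real m \<le> (?E + \<epsilon> + K * ?p N + K * real N / real m) * real m"
        using that by (simp add: algebra_simps)
      then show ?thesis using that by simp
    qed
    then show "\<exists>n0. \<forall>m\<ge>n0. growth \<le> ?E + \<epsilon> + K * ?p N + K * real N / real m" by blast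
  qed
  \<comment> \<open>Continuity from above; the intersection is empty because every point has some
    finite near-optimal length.\<close>
  have "(\<lambda>N. ?p N) \<longlonglongrightarrow> measure \<mu> (\<Inter>N. {x \<in> space \<mu>. late \<epsilon> N x})"
    by (rule finite_Lim_measure_decseq) (auto simp: decseq_def late_def)
  moreover have "(\<Inter>N. {x \<in> space \<mu>. late \<epsilon> N x}) = {}"
  proof -
    have "\<exists>N. \<not> late \<epsilon> N x" for x
    proof -
      obtain n where "n \<ge> 1" "f (word n x) \<le> real n * (lower_rate x + \<epsilon>)"
        using ex_near_lower_rate[OF eps] by blast
      then have "\<not> late \<epsilon> n x" by (force simp: late_def)
      then show ?thesis ..
    qed
    then show ?thesis by blast
  qed
  ultimately have "(\<lambda>N. ?p N) \<longlonglongrightarrow> 0" by simp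
  then have "(\<lambda>N. ?E + \<epsilon> + K * ?p N) \<longlonglongrightarrow> ?E + \<epsilon> + K * 0"
    by (intro tendsto_intros)
  then have "growth \<le> ?E + \<epsilon> + K * 0"
    by (rule LIMSEQ_le_const) (use le in blast)
  then show "growth \<le> ?E + \<epsilon>" by simp
qed

text \<open>Almost surely the limsup is at most \<open>growth\<close>, so
  \<open>growth - lower_rate x\<close> is nonnegative almost everywhere. Its integral is at most 0,
  hence it vanishes almost everywhere, and liminf and limsup agree.\<close>

lemma AE_tendsto_growth: "AE x in \<mu>. (\<lambda>n. f (word n x) / real n) \<longlonglongrightarrow> growth"
proof -
  interpret prob_space \<mu> by (rule prob_space_bernoulli_shift_measure)
  \<comment> \<open>Countably many rates decreasing to \<open>growth\<close> are used, so that one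
    null set serves for all of them.\<close>
  have "AE x in \<mu>. \<forall>k. eventually (\<lambda>n. f (word n x) \<le> (growth + inverse (real (Suc k))) * real n) sequentially"
    by (subst AE_all_countable) (auto intro!: AE_upper)
  then have up: "AE x in \<mu>. \<forall>k. eventually (\<lambda>n. f (word n x) / real n \<le> growth + inverse (real (Suc k))) sequentially"
  proof eventually_elim
    case (elim x)
    show ?case
    proof
      fix k
      from elim have "eventually (\<lambda>n. f (word n x) \<le> (growth + inverse (real (Suc k))) * real n) sequentially" by blast
      with eventually_gt_at_top[of 0]
      show "eventually (\<lambda>n. f (word n x) / real n \<le> growth + inverse (real (Suc k))) sequentially"
        by eventually_elim (simp add: pos_divide_le_eq del: of_nat_Suc)
    qed
  qed
  have le: "AE x in \<mu>. lower_rate x \<le> growth" using up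
  proof eventually_elim
    case (elim x)
    have "lower_rate x \<le> growth + inverse (real (Suc k))" for k
    proof (rule ccontr)
      assume "\<not> ?thesis"
      then have "eventually (\<lambda>n. growth + inverse (real (Suc k)) < f (word n x) / real n) sequentially"
        by (intro eventually_lower_rate) simp
      moreover have "eventually (\<lambda>n. f (word n x) / real n \<le> growth + inverse (real (Suc k))) sequentially"
        using elim by blast
      ultimately have "eventually (\<lambda>n::nat. False) sequentially" by eventually_elim linarith
      then show False by simp
    qed
    moreover have "(\<lambda>k. growth + inverse (real (Suc k))) \<longlonglongrightarrow> growth + 0"
      by (intro tendsto_intros LIMSEQ_inverse_real_of_nat)
    ultimately show ?case using LIMSEQ_le_const[of _ "growth + 0"] by auto
  qed
  have il: "integrable \<mu> lower_rate"
    by (rule integrable_bounded[of _ K]) (use lower_rate_bounds in auto)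
  have int: "integrable \<mu> (\<lambda>x. growth - lower_rate x)" using il by simp
  have nn: "AE x in \<mu>. 0 \<le> growth - lower_rate x" using le by eventually_elim simp
  have "(\<integral>x. growth - lower_rate x \<partial>\<mu>) = growth - (\<integral>x. lower_rate x \<partial>\<mu>)" using il by (simp add: prob_space)
  then have "(\<integral>x. growth - lower_rate x \<partial>\<mu>) \<le> 0" using growth_le_expectation by simp
  with integral_nonneg_AE[OF nn] have "(\<integral>x. growth - lower_rate x \<partial>\<mu>) = 0" by simp
  with integral_nonneg_eq_0_iff_AE[OF int nn] have "AE x in \<mu>. growth - lower_rate x = 0" by simp
  with up show ?thesis
  proof eventually_elim
    case (elim x)
    have "eventually (\<lambda>n. y < f (word n x) / real n) sequentially" if "y < growth" for y
      using that elim by (intro eventually_lower_rate) simp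
    moreover have "eventually (\<lambda>n. f (word n x) / real n < y) sequentially" if y: "y > growth" for y
    proof -
      obtain k where "inverse (real (Suc k)) < y - growth" using y reals_Archimedean[of "y - growth"] by auto
      moreover have "eventually (\<lambda>n. f (word n x) / real n \<le> growth + inverse (real (Suc k))) sequentially"
        using elim by blast
      ultimately show ?thesis by (auto elim!: eventually_mono)
    qed
    ultimately show ?case by (rule order_tendstoI)
  qed
qed

end

section \<open>Words of matrices\<close>

definition letter :: "cocycle \<Rightarrow> nat \<Rightarrow> mat2" where
  "letter A a = (if a = 1 then fst A else snd A)"

text \<open>The head of the word acts first, so it is the rightmost factor; concatenation of words
  therefore reverses the order of the products.\<close>

primrec word_mat :: "cocycle \<Rightarrow> nat list \<Rightarrow> mat2" where
  "word_mat A [] = mat 1"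
| "word_mat A (a # w) = word_mat A w ** letter A a"

lemma word_mat_append: "word_mat A (u @ w) = word_mat A w ** word_mat A u"
  by (induction u) (simp_all add: matrix_mul_assoc)

lemma cocycle_iterate_eq: "cocycle_iterate A n x = word_mat A (word n x)"
proof (induction n)
  case 0
  then show ?case by (simp add: word_def)
next
  case (Suc n)
  have "word (Suc n) x = word n x @ [((shift ^^ n) x) 0]"
    by (simp add: word_def shift_funpow)
  then show ?case using Suc by (simp add: word_mat_append cocycle_map_def letter_def)
qed

lemma det_letter: "A \<in> cocycles \<Longrightarrow> det (letter A a) = 1"
  by (auto simp: cocycles_def SL2_def letter_def)

lemma det_word_mat: "A \<in> cocycles \<Longrightarrow> det (word_mat A w) = 1"
  by (induction w) (simp_all add: det_mul det_letter)

section \<open>The operator norm on matrices of determinant 1\<close>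

lemma norm_mult_vec_le: "norm (M *v v) \<le> mat_norm M * norm v" for M :: mat2
  unfolding mat_norm_def by (rule onorm) simp

lemma mat_norm_nonneg: "0 \<le> mat_norm M"
  unfolding mat_norm_def by (rule onorm_pos_le) simp

lemma mat_norm_mult_le: "mat_norm (M ** N) \<le> mat_norm M * mat_norm N"
proof -
  have "((*v) (M ** N)) = (*v) M \<circ> (*v) N"
    by (auto simp: matrix_vector_mul_assoc)
  then show ?thesis unfolding mat_norm_def by (simp add: onorm_compose)
qed

lemma mat_norm_1 [simp]: "mat_norm (mat 1) = 1"
proof -
  have "(*v) (mat 1 :: mat2) = (\<lambda>v. v)" by (simp add: fun_eq_iff)
  then show ?thesis by (simp add: mat_norm_def onorm_id)
qed

lemma obtain_inverse:
  fixes M :: mat2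
  assumes "det M = 1"
  obtains N where "N ** M = mat 1" "M ** N = mat 1" "det N = 1"
proof -
  have "invertible M" using assms by (simp add: invertible_det_nz)
  then obtain N where N: "M ** N = mat 1" "N ** M = mat 1" unfolding invertible_def by blast
  have "det (N ** M) = 1" using N by simp
  then have "det N = 1" using assms by (simp add: det_mul)
  with N that show thesis by blast
qed

text \<open>Hadamard's inequality: the determinant is at most the product of the lengths of the two
  columns, and each column is the image of a unit vector.\<close>

lemma mat_norm_ge_1:
  assumes "det M = 1"
  shows "1 \<le> mat_norm M"
proof -
  let ?a = "axis 1 1 :: real^2" and ?b = "axis 2 1 :: real^2"
  have d: "det M = (M *v ?a) $ 1 * (M *v ?b) $ 2 - (M *v ?b) $ 1 * (M *v ?a) $ 2"
    by (simp add: det_2 matrix_vector_mult_basis column_def)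
  have "(p * s - q * r)\<^sup>2 \<le> (p\<^sup>2 + r\<^sup>2) * (q\<^sup>2 + s\<^sup>2)" for p q r s :: real
  proof -
    \<comment> \<open>Lagrange's identity for the columns \<open>(p, r)\<close> and
      \<open>(q, s)\<close>.\<close>
    have "(p\<^sup>2 + r\<^sup>2) * (q\<^sup>2 + s\<^sup>2) - (p * s - q * r)\<^sup>2 = (p * q + r * s)\<^sup>2"
      by (simp add: power2_eq_square algebra_simps)
    then show ?thesis using zero_le_power2[of "p * q + r * s"] by linarith
  qed
  from this [of "(M *v ?a) $ 1" "(M *v ?b) $ 2" "(M *v ?b) $ 1" "(M *v ?a) $ 2"]
  have "1\<^sup>2 \<le> ((M *v ?a) $ 1 ^ 2 + (M *v ?a) $ 2 ^ 2) * ((M *v ?b) $ 1 ^ 2 + (M *v ?b) $ 2 ^ 2)"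
    unfolding d [symmetric] assms .
  also have "\<dots> = (norm (M *v ?a) * norm (M *v ?b))\<^sup>2"
    by (simp add: norm_vec_def L2_set_def sum_2 power_mult_distrib)
  finally have "1 \<le> norm (M *v ?a) * norm (M *v ?b)"
    by (rule power2_le_imp_le) simp
  also have "\<dots> \<le> mat_norm M * mat_norm M"
    using norm_mult_vec_le[of M ?a] norm_mult_vec_le[of M ?b] mat_norm_nonneg
    by (intro mult_mono) auto
  finally have "1\<^sup>2 \<le> (mat_norm M)\<^sup>2" by (simp add: power2_eq_square)
  then show ?thesis using mat_norm_nonneg[of M] by (rule power2_le_imp_le)
qed

section \<open>Almost invariant functions on the plane\<close>

text \<open>The preimage of a box is its image under the inverse matrix, which preserves volume;
  boxes determine Lebesgue measure.\<close>

lemma distr_lborel_mult_vec: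
  fixes M :: "real^'n::{finite,wellorder}^'n::{finite,wellorder}"
  assumes "\<bar>det M\<bar> = 1"
  shows "distr lborel borel ((*v) M) = lborel"
proof (rule lborel_eqI [symmetric])
  have "invertible M" using assms by (auto simp: invertible_det_nz)
  then obtain N where N: "M ** N = mat 1" "N ** M = mat 1" unfolding invertible_def by blast
  have "\<bar>det (N ** M)\<bar> = 1" using N by simp
  then have detN: "\<bar>det N\<bar> = 1" using assms by (simp add: det_mul abs_mult)
  fix l u :: "(real, 'n) vec" assume "\<And>b. b \<in> Basis \<Longrightarrow> l \<bullet> b \<le> u \<bullet> b"
  have eq: "(*v) M -` box l u = (*v) N ` box l u"
  proof (rule set_eqI)
    fix x
    have "M *v (N *v y) = y" "N *v (M *v y) = y" for y
      by (simp_all add: matrix_vector_mul_assoc N)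
    then show "x \<in> (*v) M -` box l u \<longleftrightarrow> x \<in> (*v) N ` box l u"
      by (auto simp: image_iff intro!: bexI [of _ "M *v x"])
  qed
  have meas: "(*v) M \<in> borel_measurable borel"
    by (intro borel_measurable_continuous_onI linear_continuous_on) simp
  have lin: "linear ((*v) N)" by simp
  have box: "(*v) M -` box l u \<in> sets borel"
    using measurable_sets[OF meas, of "box l u"] by simp
  have "emeasure (distr lborel borel ((*v) M)) (box l u) = emeasure lborel ((*v) M -` box l u)"
    using meas by (subst emeasure_distr) auto
  also have "\<dots> = emeasure lebesgue ((*v) M -` box l u)"
    using box by simp
  also have "\<dots> = ennreal (measure lebesgue ((*v) N ` box l u))"
    unfolding eq by (intro emeasure_eq_measure2 measurable_linear_image[OF lin] lmeasurable_box)
  also have "measure lebesgue ((*v) N ` box l u) = measure lebesgue (box l u)"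
    by (subst measure_linear_image[OF lin]) (use detN in \<open>auto simp: matrix_of_matrix_vector_mul\<close>)
  also have "ennreal \<dots> = emeasure lborel (box l u)"
    using emeasure_eq_measure2 [OF lmeasurable_box, of l u] by simp
  finally show "emeasure (distr lborel borel ((*v) M)) (box l u) = ennreal (\<Prod>b\<in>Basis. (u - l) \<bullet> b)"
    using \<open>\<And>b. b \<in> Basis \<Longrightarrow> l \<bullet> b \<le> u \<bullet> b\<close> by (simp add: emeasure_lborel_box)
qed simp

lemma measurable_mult_vec [measurable]: "(*v) M \<in> borel_measurable borel" for M :: mat2
  by (intro borel_measurable_continuous_onI linear_continuous_on) simp

lemma integral_mult_vec:
  fixes F :: "real^2 \<Rightarrow> real"
  assumes "det M = 1" "F \<in> borel_measurable borel"
  shows "(\<integral>v. F (M *v v) \<partial>lborel) = (\<integral>v. F v \<partial>lborel)"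
    and "integrable lborel (\<lambda>v. F (M *v v)) \<longleftrightarrow> integrable lborel F"
proof -
  have d: "distr lborel borel ((*v) M) = (lborel :: (real^2) measure)"
    using assms by (intro distr_lborel_mult_vec) simp
  show "(\<integral>v. F (M *v v) \<partial>lborel) = (\<integral>v. F v \<partial>lborel)"
    using integral_distr[of "(*v) M" lborel borel F] assms by (simp add: d)
  show "integrable lborel (\<lambda>v. F (M *v v)) \<longleftrightarrow> integrable lborel F"
    using integrable_distr_eq[of "(*v) M" lborel borel F] assms by (simp add: d)
qed

text \<open>Evenness makes composition with -1, the square of the perturbed rotation, trivial. The
  value 0 at the origin lets pointwise estimates ignore the one vector that no matrix moves.\<close>

definition even_L2 :: "(real^2 \<Rightarrow> real) \<Rightarrow> bool" where
  "even_L2 F \<longleftrightarrow> F \<in> borel_measurable borel \<and> integrable lborel (\<lambda>v. (F v)\<^sup>2)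
     \<and> F 0 = 0 \<and> (\<forall>v. F (- v) = F v)"

text \<open>The squared L2 distance between \<open>F\<close> and its translate by \<open>M\<close>;
  small energy means almost invariance.\<close>

definition energy :: "mat2 \<Rightarrow> (real^2 \<Rightarrow> real) \<Rightarrow> real" where
  "energy M F = (\<integral>v. (F (M *v v) - F v)\<^sup>2 \<partial>lborel)"

definition mass :: "(real^2 \<Rightarrow> real) \<Rightarrow> (real^2) set \<Rightarrow> real" where
  "mass F S = (\<integral>v. (F v)\<^sup>2 * indicator S v \<partial>lborel)"

lemma even_L2_measurable: "even_L2 F \<Longrightarrow> F \<in> borel_measurable borel"
  and even_L2_integrable: "even_L2 F \<Longrightarrow> integrable lborel (\<lambda>v. (F v)\<^sup>2)"
  and even_L2_0: "even_L2 F \<Longrightarrow> F 0 = 0"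
  and even_L2_minus: "even_L2 F \<Longrightarrow> F (- v) = F v"
  by (simp_all add: even_L2_def)

lemma even_L2_mult_vec:
  assumes "even_L2 F" "det M = 1"
  shows "even_L2 (\<lambda>v. F (M *v v))"
proof -
  note [measurable] = even_L2_measurable[OF assms(1)]
  have "integrable lborel (\<lambda>v. (F (M *v v))\<^sup>2)"
    using integral_mult_vec(2)[OF assms(2), of "\<lambda>v. (F v)\<^sup>2"] even_L2_integrable[OF assms(1)] by simp
  moreover have "M *v (- v) = - (M *v v)" for v by (rule linear_neg) simp
  ultimately show ?thesis
    unfolding even_L2_def by (simp add: even_L2_0 [OF assms(1)] even_L2_minus [OF assms(1)])
qed

lemma integrable_lincomb_sq:
  assumes "even_L2 F" "even_L2 G"
  shows "integrable lborel (\<lambda>v. (a * F v + b * G v)\<^sup>2)"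
proof (rule Bochner_Integration.integrable_bound)
  note [measurable] = even_L2_measurable[OF assms(1)] even_L2_measurable[OF assms(2)]
  show "integrable lborel (\<lambda>v. 2 * (a\<^sup>2 * (F v)\<^sup>2) + 2 * (b\<^sup>2 * (G v)\<^sup>2))"
    using assms by (intro Bochner_Integration.integrable_add integrable_mult_right even_L2_integrable)
  show "(\<lambda>v. (a * F v + b * G v)\<^sup>2) \<in> borel_measurable lborel" by measurable
  have "(p + q)\<^sup>2 \<le> 2 * p\<^sup>2 + 2 * q\<^sup>2" for p q :: real
    using zero_le_power2[of "p - q"] by (simp add: power2_eq_square algebra_simps)
  from this[of "a * F _" "b * G _"]
  show "AE v in lborel. norm ((a * F v + b * G v)\<^sup>2) \<le> norm (2 * (a\<^sup>2 * (F v)\<^sup>2) + 2 * (b\<^sup>2 * (G v)\<^sup>2))"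
    by (simp add: power_mult_distrib)
qed

lemma integrable_diff_sq:
  assumes "even_L2 F" "even_L2 G"
  shows "integrable lborel (\<lambda>v. (F v - G v)\<^sup>2)"
  using integrable_lincomb_sq[OF assms, of 1 "-1"] by simp

lemma integrable_mass:
  assumes "even_L2 F" "S \<in> sets borel"
  shows "integrable lborel (\<lambda>v. (F v)\<^sup>2 * indicator S v)"
  using assms by (intro integrable_real_mult_indicator even_L2_integrable) simp

text \<open>Where \<open>M\<close> carries \<open>S\<close> into \<open>S'\<close>,
  \<open>F v\<close> differs from \<open>F (M *v v)\<close> by an amount that the energy controls in
  the mean; substituting \<open>M *v v\<close> preserves area and turns the first term into the mass
  of \<open>S'\<close>.\<close>

lemma transport:
  assumes F: "even_L2 F" and "det M = 1" and S: "S \<in> sets borel" and S': "S' \<in> sets borel"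
    and sub: "\<And>v. v \<in> S \<Longrightarrow> v \<noteq> 0 \<Longrightarrow> M *v v \<in> S'"
  shows "mass F S \<le> 2 * mass F S' + 2 * energy M F"
proof -
  note [measurable] = even_L2_measurable[OF F] S S'
  let ?G = "\<lambda>v. (F v)\<^sup>2 * indicator S' v"
  have int: "integrable lborel (\<lambda>v. ?G (M *v v))"
    by (subst integral_mult_vec(2)[OF assms(2)]) (auto intro: integrable_mass[OF F S'])
  have "mass F S \<le> (\<integral>v. 2 * ?G (M *v v) + 2 * (F (M *v v) - F v)\<^sup>2 \<partial>lborel)"
    unfolding mass_def
  proof (rule integral_mono)
    show "integrable lborel (\<lambda>v. (F v)\<^sup>2 * indicator S v)" by (rule integrable_mass[OF F S])
    show "integrable lborel (\<lambda>v. 2 * ?G (M *v v) + 2 * (F (M *v v) - F v)\<^sup>2)"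
      by (intro Bochner_Integration.integrable_add integrable_mult_right int integrable_diff_sq
          even_L2_mult_vec F assms(2))
    fix v
    \<comment> \<open>The right side minus the left side is
      \<open>(2 * p - q)\<^sup>2\<close>.\<close>
    have "q\<^sup>2 \<le> 2 * p\<^sup>2 + 2 * (p - q)\<^sup>2" for p q :: real
      using zero_le_power2[of "2 * p - q"] by (simp add: power2_eq_square algebra_simps)
    from this[of "F v" "F (M *v v)"] show "(F v)\<^sup>2 * indicator S v \<le> 2 * ?G (M *v v) + 2 * (F (M *v v) - F v)\<^sup>2"
      using sub[of v] even_L2_0[OF F] by (cases "v = 0"; cases "v \<in> S") (auto simp: indicator_def)
  qed
  also have "\<dots> = 2 * (\<integral>v. ?G (M *v v) \<partial>lborel) + 2 * energy M F"
    unfolding energy_def using int integrable_diff_sq[OF even_L2_mult_vec[OF F assms(2)] F]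
    by (subst Bochner_Integration.integral_add) auto
  also have "(\<integral>v. ?G (M *v v) \<partial>lborel) = mass F S'"
    unfolding mass_def by (rule integral_mult_vec(1)[OF assms(2)]) measurable
  finally show ?thesis .
qed

section \<open>Diagonal matrices, the perturbed rotation and their action on sectors\<close>

definition hyp :: "real \<Rightarrow> mat2" where
  "hyp s = vector [vector [exp s, 0], vector [0, exp (- s)]]"

lemma det_hyp [simp]: "det (hyp s) = 1"
  by (simp add: hyp_def det_2 exp_minus)

lemma hyp_mult_vec: "hyp s *v v = vector [exp s * v $ 1, exp (- s) * v $ 2]"
  by (simp add: hyp_def vec_eq_iff forall_2 matrix_vector_mult_def sum_2)

lemma hyp_0: "hyp 0 *v v = v"
  by (simp add: hyp_mult_vec vec_eq_iff forall_2)

lemma hyp_add: "hyp (r + s) *v v = hyp r *v (hyp s *v v)"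
  by (simp add: hyp_mult_vec vec_eq_iff forall_2 mult_exp_exp flip: mult.assoc)

lemma D_mat_eq: "D_mat = hyp 1"
  by (simp add: D_mat_def hyp_def)

lemma energy_nonneg: "0 \<le> energy M F"
  unfolding energy_def by (rule Bochner_Integration.integral_nonneg) simp

text \<open>The triangle inequality in L2, in squared form: moving by \<open>j\<close> steps costs
  at most \<open>j\<close> times the L2 norm of one difference.\<close>

lemma energy_hyp_le:
  assumes F: "even_L2 F"
  shows "energy (hyp (real j * s)) F \<le> (real j)\<^sup>2 * energy (hyp s) F"
proof (induction j)
  case 0
  then show ?case by (simp add: energy_def hyp_0)
next
  case (Suc j)
  note [measurable] = even_L2_measurable[OF F]
  let ?h = "\<lambda>r v. hyp r *v v" and ?e = "energy (hyp s) F"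
  show ?case
  proof (cases "j = 0")
    case False
    then have j: "real j > 0" by simp
    let ?A = "\<lambda>v. (F (?h (real j * s) (?h s v)) - F (?h s v))\<^sup>2" and ?B = "\<lambda>v. (F (?h s v) - F v)\<^sup>2"
    have intA: "integrable lborel ?A"
      by (intro integrable_diff_sq even_L2_mult_vec[of "\<lambda>v. F (?h (real j * s) v)"] even_L2_mult_vec F) auto
    have intB: "integrable lborel ?B" by (intro integrable_diff_sq even_L2_mult_vec F) auto
    have "energy (hyp (real (Suc j) * s)) F = (\<integral>v. (F (?h (real j * s) (?h s v)) - F v)\<^sup>2 \<partial>lborel)"
      unfolding energy_def by (simp add: hyp_add [symmetric] algebra_simps)
    also have "\<dots> \<le> (\<integral>v. (1 + 1 / real j) * ?A v + (1 + real j) * ?B v \<partial>lborel)"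
    proof (rule integral_mono)
      show "integrable lborel (\<lambda>v. (F (?h (real j * s) (?h s v)) - F v)\<^sup>2)"
        by (intro integrable_diff_sq even_L2_mult_vec[of "\<lambda>v. F (?h (real j * s) v)"] even_L2_mult_vec F) auto
      show "integrable lborel (\<lambda>v. (1 + 1 / real j) * ?A v + (1 + real j) * ?B v)"
        by (intro Bochner_Integration.integrable_add integrable_mult_right intA intB)
      fix v
      \<comment> \<open>These weights are optimal for energies in the ratio \<open>j\<^sup>2\<close>
        to 1: they turn the two terms into exactly \<open>(j + 1)\<^sup>2\<close>.\<close>
      have "(p + q)\<^sup>2 \<le> (1 + 1 / real j) * p\<^sup>2 + (1 + real j) * q\<^sup>2" for p q :: real
      proof -
        have "(1 + 1 / real j) * p\<^sup>2 + (1 + real j) * q\<^sup>2 - (p + q)\<^sup>2 = (p - real j * q)\<^sup>2 / real j"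
          using j by (simp add: power2_eq_square field_simps)
        also have "\<dots> \<ge> 0" using j by simp
        finally show ?thesis by simp
      qed
      from this[of "F (?h (real j * s) (?h s v)) - F (?h s v)" "F (?h s v) - F v"]
      show "(F (?h (real j * s) (?h s v)) - F v)\<^sup>2 \<le> (1 + 1 / real j) * ?A v + (1 + real j) * ?B v"
        by simp
    qed
    also have "\<dots> = (1 + 1 / real j) * (\<integral>v. ?A v \<partial>lborel) + (1 + real j) * ?e"
      using intA intB by (simp add: energy_def)
    also have "(\<integral>v. ?A v \<partial>lborel) = energy (hyp (real j * s)) F"
      unfolding energy_def
      by (rule integral_mult_vec(1)[of "hyp s" "\<lambda>v. (F (?h (real j * s) v) - F v)\<^sup>2"]) auto
    also have "(1 + 1 / real j) * energy (hyp (real j * s)) F \<le> (1 + 1 / real j) * ((real j)\<^sup>2 * ?e)"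
      using Suc j by (intro mult_left_mono) auto
    also have "(1 + 1 / real j) * ((real j)\<^sup>2 * ?e) + (1 + real j) * ?e = (real (Suc j))\<^sup>2 * ?e"
      using j by (simp add: power2_eq_square field_simps)
    finally show ?thesis by simp
  qed (simp add: energy_def)
qed

text \<open>For positive \<open>c\<close> a closed double cone around the first axis, narrower for
  larger \<open>c\<close>. Differences of two such cones are ranges of the ratio of the
  coordinates.\<close>

definition sector :: "real \<Rightarrow> (real^2) set" where
  "sector c = {v. c * \<bar>v $ 2\<bar> \<le> \<bar>v $ 1\<bar>}"

lemma sector_borel [measurable]: "sector c \<in> sets borel"
proof -
  have "closed (sector c)"
    unfolding sector_def by (intro closed_Collect_le continuous_intros)
  then show ?thesis by (rule borel_closed)
qed

lemma sector_antimono: "c \<le> d \<Longrightarrow> sector d \<subseteq> sector c"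
proof
  fix v assume "c \<le> d" "v \<in> sector d"
  moreover from this have "c * \<bar>v $ 2\<bar> \<le> d * \<bar>v $ 2\<bar>" by (intro mult_right_mono) auto
  ultimately show "v \<in> sector c" by (simp add: sector_def)
qed

text \<open>\<open>hyp s\<close> multiplies the ratio of the absolute coordinates by
  \<open>exp (2 * s)\<close>.\<close>

lemma hyp_in_sector_iff: "hyp s *v v \<in> sector c \<longleftrightarrow> v \<in> sector (c * exp (- 2 * s))"
proof -
  have "c * exp (- 2 * s) * \<bar>v $ 2\<bar> \<le> \<bar>v $ 1\<bar>
      \<longleftrightarrow> exp s * (c * exp (- 2 * s) * \<bar>v $ 2\<bar>) \<le> exp s * \<bar>v $ 1\<bar>"
    by (simp only: mult_le_cancel_left_pos exp_gt_zero)
  also have "exp s * (c * exp (- 2 * s) * \<bar>v $ 2\<bar>) = c * ((exp s * exp (- 2 * s)) * \<bar>v $ 2\<bar>)"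
    by simp
  also have "exp s * exp (- 2 * s) = exp (- s)" by (simp add: mult_exp_exp)
  finally show ?thesis
    by (simp add: sector_def hyp_mult_vec abs_mult mult.assoc)
qed

text \<open>The conjugate of \<open>C_mat\<close> under the upper unipotent matrix with entry
  \<open>t\<close>.\<close>

definition C_pert :: "real \<Rightarrow> mat2" where
  "C_pert t = vector [vector [t, - (1 + t\<^sup>2)], vector [1, - t]]"

lemma det_C_pert [simp]: "det (C_pert t) = 1"
  by (simp add: C_pert_def det_2 power2_eq_square)

lemma C_pert_mult_vec:
  "C_pert t *v v = vector [t * v $ 1 - (1 + t\<^sup>2) * v $ 2, v $ 1 - t * v $ 2]"
  by (simp add: C_pert_def vec_eq_iff forall_2 matrix_vector_mult_def sum_2 algebra_simps)

lemma C_pert_C_pert: "C_pert t *v (C_pert t *v v) = - v"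
  by (simp add: C_pert_mult_vec vec_eq_iff forall_2 power2_eq_square algebra_simps)

text \<open>The first axis goes to a line of coordinate ratio \<open>t\<close>, the second to one of
  ratio \<open>(1 + t\<^sup>2) / t\<close>. So vectors close to the first axis land between the
  ratios \<open>t / 4\<close> and \<open>1 / t\<close>, and vectors close to the second axis land
  away from it.\<close>

lemma C_pert_sector:
  assumes t: "0 < t" "t \<le> 1 / 2"
  shows "v \<in> sector (4 / t) \<Longrightarrow> C_pert t *v v \<in> sector (t / 4)"
    and "v \<in> sector (4 / t) \<Longrightarrow> v \<noteq> 0 \<Longrightarrow> C_pert t *v v \<notin> sector (1 / t)"
    and "v \<notin> sector t \<Longrightarrow> C_pert t *v v \<in> sector (t / 4)"
proof -
  define x y where "x = v $ 1" and "y = v $ 2"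
  define X Y where "X = \<bar>x\<bar>" and "Y = \<bar>y\<bar>"
  \<comment> \<open>Absolute values of the second and the first coordinate of the image, in this
    order.\<close>
  define P Q where "P = \<bar>x - t * y\<bar>" and "Q = \<bar>t * x - (1 + t\<^sup>2) * y\<bar>"
  have X0: "X \<ge> 0" and Y0: "Y \<ge> 0" by (simp_all add: X_def Y_def)
  have t2: "t\<^sup>2 \<le> 1 / 4" using t power_mono[of t "1/2" 2] by (simp add: power2_eq_square)
  have absY: "\<bar>(1 + t\<^sup>2) * y\<bar> = (1 + t\<^sup>2) * Y" by (simp add: abs_mult Y_def)
  have absX: "\<bar>t * x\<bar> = t * X" "\<bar>t * y\<bar> = t * Y" using t by (simp_all add: abs_mult X_def Y_def)
  have up1: "P \<le> X + t * Y" and lo1: "X - t * Y \<le> P"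
    using abs_triangle_ineq4[of x "t * y"] abs_triangle_ineq2[of x "t * y"]
    by (simp_all add: P_def absX flip: X_def)
  have up2: "Q \<le> t * X + (1 + t\<^sup>2) * Y" and lo2: "t * X - (1 + t\<^sup>2) * Y \<le> Q"
    using abs_triangle_ineq4[of "t * x" "(1 + t\<^sup>2) * y"] abs_triangle_ineq2[of "t * x" "(1 + t\<^sup>2) * y"]
    unfolding absX absY Q_def [symmetric] .
  have lo3: "(1 + t\<^sup>2) * Y - t * X \<le> Q"
    using abs_triangle_ineq2[of "(1 + t\<^sup>2) * y" "t * x"]
    unfolding absX absY abs_minus_commute [of "(1 + t\<^sup>2) * y"] Q_def [symmetric] .
  have tY: "t * Y \<le> Y / 2" "(1 + t\<^sup>2) * Y \<le> 5 / 4 * Y" and tX: "t * X \<le> X / 2"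
    using t t2 X0 Y0 mult_right_mono[of t "1/2" Y] mult_right_mono[of "1 + t\<^sup>2" "5/4" Y]
      mult_right_mono[of t "1/2" X] by simp_all
  have in_sector: "C_pert t *v v \<in> sector c \<longleftrightarrow> c * P \<le> Q" for c
    by (simp add: sector_def C_pert_mult_vec x_def y_def P_def Q_def)
  have tm: "t / 4 * P \<le> t / 4 * (X + t * Y)"
    using up1 t by (intro mult_left_mono) auto
  {
    assume "v \<in> sector (4 / t)"
    then have y4: "4 * Y \<le> t * X" using t by (simp add: sector_def X_def Y_def x_def y_def field_simps)
    have "t / 4 * (X + t * Y) = t * X / 4 + t\<^sup>2 * Y / 4" by (simp add: power2_eq_square algebra_simps)
    moreover have "t\<^sup>2 * Y \<le> 1 / 4 * Y" using t2 Y0 by (intro mult_right_mono) auto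
    ultimately have "t / 4 * P \<le> t * X / 4 + Y / 16" using tm by linarith
    also have "\<dots> \<le> t * X - (1 + t\<^sup>2) * Y" using y4 tY Y0 by linarith
    also note lo2
    finally show "C_pert t *v v \<in> sector (t / 4)" unfolding in_sector .
    assume "v \<noteq> 0"
    have "x \<noteq> 0"
    proof
      assume "x = 0"
      with y4 have "y = 0" by (simp add: X_def Y_def)
      with \<open>x = 0\<close> \<open>v \<noteq> 0\<close> show False by (simp add: x_def y_def vec_eq_iff forall_2)
    qed
    then have x0: "X > 0" by (simp add: X_def)
    have "Q \<le> t * X + 5 / 4 * Y" using up2 tY by linarith
    also have "\<dots> \<le> X" using y4 tX x0 by linarith
    finally have "t * Q \<le> t * X" using t by (intro mult_left_mono) auto
    also have "t * X < X - t * Y" using y4 tX tY x0 by linarith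
    also note lo1
    finally show "C_pert t *v v \<notin> sector (1 / t)"
      unfolding in_sector using t by (simp add: field_simps)
  next
    assume "v \<notin> sector t"
    then have xy: "X < t * Y" by (simp add: sector_def X_def Y_def x_def y_def)
    \<comment> \<open>The term \<open>t\<^sup>2 * Y\<close> in \<open>lo3\<close> compensates
      exactly for this loss, leaving \<open>Y\<close> as a lower bound for \<open>Q\<close>.\<close>
    have "t * X \<le> t * (t * Y)" using xy t by (intro mult_left_mono) auto
    then have "t * X \<le> t\<^sup>2 * Y" by (simp add: power2_eq_square mult.assoc)
    then have ge: "Y \<le> Q" using lo3 by (simp add: algebra_simps)
    have "t / 4 * P \<le> 1 * P" using t by (intro mult_right_mono) (auto simp: P_def)
    also have "\<dots> \<le> Y" using up1 xy tY by linarith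
    also note ge
    finally show "C_pert t *v v \<in> sector (t / 4)" unfolding in_sector .
  }
qed

section \<open>Mass in a window of directions\<close>

lemma mass_union:
  assumes "even_L2 F" "S \<in> sets borel" "T \<in> sets borel" "S \<inter> T = {}"
  shows "mass F (S \<union> T) = mass F S + mass F T"
proof -
  have "mass F (S \<union> T) = (\<integral>v. (F v)\<^sup>2 * indicator S v + (F v)\<^sup>2 * indicator T v \<partial>lborel)"
    unfolding mass_def using assms(4) by (intro Bochner_Integration.integral_cong) (auto simp: indicator_def)
  also have "\<dots> = mass F S + mass F T"
    unfolding mass_def using assms by (intro Bochner_Integration.integral_add integrable_mass)
  finally show ?thesis .
qed

lemma mass_mono:
  assumes "even_L2 F" "S \<in> sets borel" "T \<in> sets borel" "S \<subseteq> T"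
  shows "mass F S \<le> mass F T"
  unfolding mass_def using assms
  by (intro integral_mono integrable_mass) (auto simp: indicator_def)

lemma mass_nonneg: "0 \<le> mass F S"
  unfolding mass_def by (rule Bochner_Integration.integral_nonneg) simp

text \<open>\<open>hyp (4 * J * i / 2)\<close>, that is \<open>J * i\<close> steps of
  \<open>hyp 2\<close>, carries window 0 onto window \<open>i\<close>. The windows are disjoint, so
  averaging the transport bound over 36 of them leaves only a small share of the total mass plus a
  multiple of the energy.\<close>

lemma mass_window:
  assumes F: "even_L2 F" and "J \<ge> 1" and "c > 0"
  shows "mass F (sector c - sector (c * exp (4 * real J)))
    \<le> mass F UNIV / 18 + 829 * (real J)\<^sup>2 * energy (hyp 2) F"
proof -
  let ?c = "\<lambda>i. c * exp (4 * real J * real i)"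
  let ?W = "\<lambda>i. sector (?c i) - sector (?c (Suc i))"
  let ?D = "energy (hyp 2) F"
  have sub: "sector (?c (Suc i)) \<subseteq> sector (?c i)" for i
  proof -
    have "4 * real J * real i \<le> 4 * real J * real (Suc i)" by (intro mult_left_mono) auto
    then show ?thesis using \<open>c > 0\<close> by (intro sector_antimono mult_left_mono) auto
  qed
  have W: "mass F (?W i) = mass F (sector (?c i)) - mass F (sector (?c (Suc i)))" for i
  proof -
    have "mass F (?W i \<union> sector (?c (Suc i))) = mass F (?W i) + mass F (sector (?c (Suc i)))"
      by (rule mass_union[OF F]) auto
    moreover have "?W i \<union> sector (?c (Suc i)) = sector (?c i)" using sub by blast
    ultimately show ?thesis by simp
  qed
  have each: "mass F (?W 0) \<le> 2 * mass F (?W i) + 2 * ((real J)\<^sup>2 * (real i)\<^sup>2 * ?D)" for i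
  proof -
    have "mass F (?W 0) \<le> 2 * mass F (?W i) + 2 * energy (hyp (real (J * i) * 2)) F"
    proof (rule transport[OF F])
      fix v assume "v \<in> ?W 0"
      moreover have "?c i * exp (- 2 * (real (J * i) * 2)) = ?c 0"
        by (simp add: mult_exp_exp)
      moreover have "?c (Suc i) * exp (- 2 * (real (J * i) * 2)) = ?c 1"
        by (simp add: mult_exp_exp algebra_simps)
      ultimately show "hyp (real (J * i) * 2) *v v \<in> ?W i"
        unfolding Diff_iff hyp_in_sector_iff by (simp only: One_nat_def simp_thms not_False_eq_True)
    qed auto
    also have "energy (hyp (real (J * i) * 2)) F \<le> (real (J * i))\<^sup>2 * ?D"
      by (rule energy_hyp_le[OF F])
    finally show ?thesis by (simp add: power_mult_distrib)
  qed
  \<comment> \<open>With 36 windows the share is \<open>2 / 36 = 1 / 18\<close>, small enough to be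
    absorbed after the factor 9 that arises in \<open>spectral_gap\<close>.\<close>
  have "36 * mass F (?W 0) = (\<Sum>i<36::nat. mass F (?W 0))" by simp
  also have "\<dots> \<le> (\<Sum>i<36::nat. 2 * mass F (?W i) + 2 * ((real J)\<^sup>2 * (real i)\<^sup>2 * ?D))"
    by (intro sum_mono each)
  also have "\<dots> = 2 * (\<Sum>i<36::nat. mass F (?W i)) + 2 * ((real J)\<^sup>2 * (\<Sum>i<36::nat. (real i)\<^sup>2) * ?D)"
    by (simp only: sum.distrib flip: sum_distrib_left sum_distrib_right)
  also have "(\<Sum>i<36::nat. (real i)\<^sup>2) = 14910"
    by (simp add: lessThan_nat_numeral)
  also have "(\<Sum>i<36::nat. mass F (?W i)) = mass F (sector (?c 0)) - mass F (sector (?c 36))"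
    unfolding W by (rule sum_lessThan_telescope')
  also have "\<dots> \<le> mass F UNIV"
    using mass_mono[OF F, of "sector (?c 0)" UNIV] mass_nonneg[of F "sector (?c 36)"] by simp
  finally have "mass F (?W 0) \<le> mass F UNIV / 18 + 29820 / 36 * ((real J)\<^sup>2 * ?D)" by simp
  moreover have "29820 / 36 * ((real J)\<^sup>2 * ?D) \<le> 829 * ((real J)\<^sup>2 * ?D)"
    by (intro mult_right_mono mult_nonneg_nonneg energy_nonneg) auto
  ultimately have "mass F (?W 0) \<le> mass F UNIV / 18 + 829 * ((real J)\<^sup>2 * ?D)" by linarith
  then show ?thesis by (simp add: mult.assoc)
qed

section \<open>The spectral gap\<close>

lemma exp_1_ge_2: "2 \<le> exp (1 :: real)"
  using exp_ge_add_one_self[of 1] by simp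

lemma exp_2_ge_4: "4 \<le> exp (2 :: real)"
  using power_mono[OF exp_1_ge_2, of 2] by (simp add: exp_double [symmetric] power2_eq_square mult_exp_exp)

text \<open>The window has little mass. The matrix \<open>?g\<close> carries the cone
  \<open>sector ?b\<close> into the window and the complement of \<open>sector t\<close> into
  \<open>sector t\<close>, so the total mass is at most 9 times that of the window plus 8 times the
  energy of \<open>?g\<close>.\<close>

lemma spectral_gap:
  assumes F: "even_L2 F" and J: "J \<ge> 1" and t: "t = exp (1 - 2 * real J)"
  shows "mass F UNIV \<le> 20000 * (real J)\<^sup>2 * (energy (hyp 1 ** C_pert t) F + energy (hyp 2) F)"
proof -
  let ?g = "hyp 1 ** C_pert t" and ?b = "t * exp (4 * real J)"
  let ?W = "sector t - sector ?b"
  let ?D = "energy (hyp 2) F" and ?E = "energy ?g F"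
  have t0: "t > 0" unfolding t by simp
  have "t \<le> exp (- 1)" unfolding t using J by simp
  also have "\<dots> \<le> 1 / 2" using exp_1_ge_2 by (simp add: exp_minus field_simps)
  finally have t1: "t \<le> 1 / 2" .
  \<comment> \<open>The choice of \<open>t\<close> makes the end of a window of logarithmic width
    \<open>4 * J\<close> starting at \<open>t\<close> equal to \<open>exp 2 / t\<close>;
    \<open>hyp 1\<close> carries the ratio \<open>1 / t\<close> exactly there.\<close>
  have b: "?b = exp 2 / t" unfolding t by (simp add: mult_exp_exp flip: exp_diff)
  have detg: "det ?g = 1" by (simp add: det_mul)
  have g: "?g *v v \<in> sector c \<longleftrightarrow> C_pert t *v v \<in> sector (c * exp (- 2))" for v c
    using hyp_in_sector_iff[of 1 "C_pert t *v v" c] by (simp add: matrix_vector_mul_assoc)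
  have e2: "exp (- 2) \<le> (1 / 4 :: real)" using exp_2_ge_4 by (simp add: exp_minus field_simps)
  have te: "t * exp (- 2) \<le> t / 4" using mult_left_mono[OF e2, of t] t0 by simp
  have be: "?b * exp (- 2) = 1 / t" unfolding b by (simp add: exp_minus field_simps)
  have b4: "4 / t \<le> ?b" unfolding b using exp_2_ge_4 t0 by (simp add: divide_right_mono)
  have tb: "t \<le> ?b" using t0 by simp
  have W: "mass F ?W \<le> mass F UNIV / 18 + 829 * (real J)\<^sup>2 * ?D"
    by (rule mass_window[OF F J t0])
  have E1: "mass F (sector ?b) \<le> 2 * mass F ?W + 2 * ?E"
  proof (rule transport[OF F detg])
    fix v :: "real^2" assume "v \<in> sector ?b" "v \<noteq> 0"
    then have v: "v \<in> sector (4 / t)" using sector_antimono[OF b4] by blast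
    show "?g *v v \<in> ?W"
      unfolding Diff_iff g be
      using C_pert_sector(1)[OF t0 t1 v] C_pert_sector(2)[OF t0 t1 v \<open>v \<noteq> 0\<close>] sector_antimono[OF te] by blast
  qed auto
  have E2: "mass F (- sector t) \<le> 2 * mass F (sector t) + 2 * ?E"
  proof (rule transport[OF F detg])
    fix v assume "v \<in> - sector t"
    then show "?g *v v \<in> sector t"
      unfolding g using C_pert_sector(3)[OF t0 t1, of v] sector_antimono[OF te] by blast
  qed auto
  have split: "mass F UNIV = mass F (sector t) + mass F (- sector t)"
    using mass_union[OF F, of "sector t" "- sector t"] by (simp add: Compl_partition)
  have "mass F (?W \<union> sector ?b) = mass F ?W + mass F (sector ?b)"
    by (rule mass_union[OF F]) auto
  moreover have "?W \<union> sector ?b = sector t" using sector_antimono[OF tb] by blast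
  ultimately have "mass F (sector t) = mass F ?W + mass F (sector ?b)" by simp
  \<comment> \<open>The factor \<open>9 / 18\<close> moves half of the total mass to the left;
    doubling the rest gives \<open>2 * 9 * 829 = 14922\<close> and
    \<open>2 * 8 = 16\<close>.\<close>
  with W [unfolded mult.assoc] E1 E2 split
  have "mass F UNIV \<le> 14922 * ((real J)\<^sup>2 * ?D) + 16 * ?E" by linarith
  also have "14922 * ((real J)\<^sup>2 * ?D) \<le> 20000 * ((real J)\<^sup>2 * ?D)"
    by (intro mult_right_mono mult_nonneg_nonneg energy_nonneg) auto
  also have "16 * ?E \<le> 20000 * (real J)\<^sup>2 * ?E"
  proof (intro mult_right_mono energy_nonneg)
    have "1 \<le> (real J)\<^sup>2" using J by simp
    then show "16 \<le> 20000 * (real J)\<^sup>2" by simp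
  qed
  finally show ?thesis by (simp add: algebra_simps)
qed

section \<open>Growth of the perturbed cocycle\<close>

definition averaging :: "cocycle \<Rightarrow> (real^2 \<Rightarrow> real) \<Rightarrow> real^2 \<Rightarrow> real" where
  "averaging A F v = (F (fst A *v v) + F (snd A *v v)) / 2"

lemma even_L2_lincomb:
  assumes "even_L2 F" "even_L2 G"
  shows "even_L2 (\<lambda>v. a * F v + b * G v)"
proof -
  note [measurable] = even_L2_measurable[OF assms(1)] even_L2_measurable[OF assms(2)]
  show ?thesis
    unfolding even_L2_def using integrable_lincomb_sq[OF assms]
    by (auto simp: even_L2_0[OF assms(1)] even_L2_0[OF assms(2)] even_L2_minus[OF assms(1)] even_L2_minus[OF assms(2)])
qed

lemma even_L2_averaging:
  assumes "even_L2 F" "A \<in> cocycles"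
  shows "even_L2 (averaging A F)"
proof -
  have "det (fst A) = 1" "det (snd A) = 1" using assms(2) by (auto simp: cocycles_def SL2_def)
  then have "even_L2 (\<lambda>v. 1 / 2 * F (fst A *v v) + 1 / 2 * F (snd A *v v))"
    using assms(1) by (intro even_L2_lincomb even_L2_mult_vec)
  moreover have "averaging A F = (\<lambda>v. 1 / 2 * F (fst A *v v) + 1 / 2 * F (snd A *v v))"
    by (simp add: averaging_def fun_eq_iff)
  ultimately show ?thesis by simp
qed

text \<open>The first letter acts first on \<open>v\<close>, so conditioning on it is one
  application of \<open>averaging\<close> on the outside.\<close>

lemma word_avg_averaging:
  "word_avg n (\<lambda>w. F (word_mat A w *v v)) = (averaging A ^^ n) F v"
proof (induction n arbitrary: v)
  case (Suc n)
  have "word_avg (Suc n) (\<lambda>w. F (word_mat A w *v v))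
    = (word_avg n (\<lambda>w. F (word_mat A w *v (fst A *v v))) + word_avg n (\<lambda>w. F (word_mat A w *v (snd A *v v)))) / 2"
    by (simp add: word_avg_Suc letter_def matrix_vector_mul_assoc)
  then show ?case by (simp add: Suc averaging_def)
qed simp

text \<open>Parametrised by \<open>J\<close>, which is comparable to the logarithm of
  \<open>1 / t\<close>.\<close>

definition pert :: "nat \<Rightarrow> cocycle" where
  "pert J = (C_pert (exp (1 - 2 * real J)), D_mat)"

lemma pert_in_cocycles: "pert J \<in> cocycles"
  by (simp add: pert_def cocycles_def SL2_def D_mat_eq)

text \<open>The denominator is 16, from averaging four functions, times the constant
  \<open>20000 * (real J)\<^sup>2\<close> of \<open>spectral_gap\<close>.\<close>

definition gap :: "nat \<Rightarrow> real" where
  "gap J = 1 / (320000 * (real J)\<^sup>2)"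

lemma mass_UNIV: "mass F UNIV = (\<integral>v. (F v)\<^sup>2 \<partial>lborel)"
  by (simp add: mass_def)

lemma mass_mult_vec:
  assumes "even_L2 F" "det M = 1"
  shows "mass (\<lambda>v. F (M *v v)) UNIV = mass F UNIV"
  unfolding mass_UNIV using even_L2_measurable[OF assms(1)] assms(2)
  by (intro integral_mult_vec(1)[of _ "\<lambda>v. (F v)\<^sup>2"]) auto

text \<open>Two averaging steps give the mean of \<open>F\<close> and its translates by
  \<open>D C\<close>, \<open>C D\<close> and \<open>D D\<close>: the term for \<open>C C\<close> is
  \<open>F\<close> itself by evenness. The L2 norm drops by the variance among the four functions,
  which \<open>spectral_gap\<close> bounds below.\<close>

lemma averaging_contraction:
  assumes F: "even_L2 F" and J: "J \<ge> 1"
  shows "mass (averaging (pert J) (averaging (pert J) F)) UNIV \<le> (1 - gap J) * mass F UNIV"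
proof -
  let ?C = "C_pert (exp (1 - 2 * real J))" and ?D = "hyp 1"
  let ?b = "\<lambda>v. F ((?D ** ?C) *v v)" and ?c = "\<lambda>v. F ((?C ** ?D) *v v)" and ?d = "\<lambda>v. F (hyp 2 *v v)"
  have b: "even_L2 ?b" and c: "even_L2 ?c" and d: "even_L2 ?d"
    by (auto intro!: even_L2_mult_vec F simp: det_mul)
  have eq: "averaging (pert J) (averaging (pert J) F) v = (F v + ?b v + ?c v + ?d v) / 4" for v
    using hyp_add[of 1 1 v] even_L2_minus[OF F]
    by (simp add: averaging_def pert_def D_mat_eq C_pert_C_pert matrix_vector_mul_assoc [symmetric]
        add_divide_distrib)
  have "mass (averaging (pert J) (averaging (pert J) F)) UNIV
      \<le> (\<integral>v. ((F v)\<^sup>2 + (?b v)\<^sup>2 + (?c v)\<^sup>2 + (?d v)\<^sup>2) / 4 - ((?b v - F v)\<^sup>2 + (?d v - F v)\<^sup>2) / 16 \<partial>lborel)"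
    unfolding mass_UNIV
  proof (rule integral_mono)
    show "integrable lborel (\<lambda>v. (averaging (pert J) (averaging (pert J) F) v)\<^sup>2)"
      by (intro even_L2_integrable even_L2_averaging F pert_in_cocycles)
    show "integrable lborel (\<lambda>v. ((F v)\<^sup>2 + (?b v)\<^sup>2 + (?c v)\<^sup>2 + (?d v)\<^sup>2) / 4 - ((?b v - F v)\<^sup>2 + (?d v - F v)\<^sup>2) / 16)"
      by (intro Bochner_Integration.integrable_diff Bochner_Integration.integrable_add integrable_divide
          integrable_diff_sq even_L2_integrable F b c d)
    fix v
    have "((x + y + z + w) / 4)\<^sup>2 \<le> (x\<^sup>2 + y\<^sup>2 + z\<^sup>2 + w\<^sup>2) / 4 - ((y - x)\<^sup>2 + (w - x)\<^sup>2) / 16" for x y z w :: real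
    proof -
      \<comment> \<open>Mean of squares minus square of the mean is the sum over all six pairs of
        squared differences, divided by 16; two pairs are kept and four discarded.\<close>
      have "(x\<^sup>2 + y\<^sup>2 + z\<^sup>2 + w\<^sup>2) / 4 - ((y - x)\<^sup>2 + (w - x)\<^sup>2) / 16 - ((x + y + z + w) / 4)\<^sup>2
         = ((x - z)\<^sup>2 + (y - z)\<^sup>2 + (y - w)\<^sup>2 + (z - w)\<^sup>2) / 16"
        by (simp add: power2_eq_square field_simps)
      also have "\<dots> \<ge> 0" by simp
      finally show ?thesis by simp
    qed
    then show "(averaging (pert J) (averaging (pert J) F) v)\<^sup>2
       \<le> ((F v)\<^sup>2 + (?b v)\<^sup>2 + (?c v)\<^sup>2 + (?d v)\<^sup>2) / 4 - ((?b v - F v)\<^sup>2 + (?d v - F v)\<^sup>2) / 16"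
      unfolding eq .
  qed
  also have "\<dots> = (mass F UNIV + mass ?b UNIV + mass ?c UNIV + mass ?d UNIV) / 4
      - (energy (?D ** ?C) F + energy (hyp 2) F) / 16"
    unfolding mass_UNIV energy_def
    by (simp add: integrable_diff_sq even_L2_integrable F b c d)
  also have "\<dots> = mass F UNIV - (energy (?D ** ?C) F + energy (hyp 2) F) / 16"
    by (simp add: mass_mult_vec F det_mul)
  finally have le: "mass (averaging (pert J) (averaging (pert J) F)) UNIV
      \<le> mass F UNIV - (energy (?D ** ?C) F + energy (hyp 2) F) / 16" .
  have "gap J * mass F UNIV \<le> gap J * (20000 * (real J)\<^sup>2 * (energy (?D ** ?C) F + energy (hyp 2) F))"
    by (intro mult_left_mono spectral_gap F J refl) (simp add: gap_def)
  also have "\<dots> = (energy (?D ** ?C) F + energy (hyp 2) F) / 16"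
    using J by (simp add: gap_def)
  finally show ?thesis using le unfolding left_diff_distrib mult_1_left by linarith
qed

lemma gap_bounds:
  assumes "J \<ge> 1"
  shows "0 < gap J" "gap J < 1"
proof -
  have "1 \<le> (real J)\<^sup>2" using assms by simp
  then have "1 < 320000 * (real J)\<^sup>2" by linarith
  then show "0 < gap J" "gap J < 1" unfolding gap_def using assms by (simp_all add: divide_less_eq)
qed

lemma mass_averaging_power:
  assumes F: "even_L2 F" and J: "J \<ge> 1"
  shows "even_L2 ((averaging (pert J) ^^ (2 * k)) F)
    \<and> mass ((averaging (pert J) ^^ (2 * k)) F) UNIV \<le> (1 - gap J) ^ k * mass F UNIV"
proof (induction k)
  case (Suc k)
  let ?G = "(averaging (pert J) ^^ (2 * k)) F"
  have eq: "(averaging (pert J) ^^ (2 * Suc k)) F = averaging (pert J) (averaging (pert J) ?G)" by simp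
  have "mass (averaging (pert J) (averaging (pert J) ?G)) UNIV \<le> (1 - gap J) * mass ?G UNIV"
    using Suc J by (intro averaging_contraction) auto
  also have "\<dots> \<le> (1 - gap J) * ((1 - gap J) ^ k * mass F UNIV)"
    using Suc gap_bounds[OF J] by (intro mult_left_mono) auto
  finally show ?case
    unfolding eq using Suc by (auto intro!: even_L2_averaging pert_in_cocycles)
qed (simp add: F)

text \<open>Indicator of the unit disc, punctured because \<open>even_L2\<close> asks for the value
  0 at the origin.\<close>

definition test_fun :: "real^2 \<Rightarrow> real" where
  "test_fun = indicator (ball 0 1 - {0})"

lemma test_fun_square: "(test_fun v)\<^sup>2 = test_fun v"
  by (simp add: test_fun_def indicator_def)

lemma even_L2_test_fun: "even_L2 test_fun"
proof -
  have "integrable lborel test_fun"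
    unfolding test_fun_def
    by (intro integrable_real_indicator emeasure_bounded_finite bounded_subset[OF bounded_ball Diff_subset]) simp
  moreover have "test_fun \<in> borel_measurable borel" 
    unfolding test_fun_def by (intro borel_measurable_indicator sets.Diff borel_open borel_closed) auto
  moreover have "test_fun 0 = 0" "test_fun (- v) = test_fun v" for v
    by (simp_all add: test_fun_def indicator_def)
  ultimately show ?thesis unfolding even_L2_def test_fun_square by blast
qed

lemma measure_punctured_ball:
  assumes "r \<ge> 0"
  shows "measure lborel (ball 0 r - {0} :: (real^2) set) = unit_ball_vol 2 * r\<^sup>2"
proof -
  have "measure lborel (ball 0 r - {0} :: (real^2) set) = measure lborel (ball 0 r :: (real^2) set)"
    by (rule measure_Diff_null_set) auto
  also have "\<dots> = unit_ball_vol 2 * r\<^sup>2"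
    using content_ball[OF assms, of "0 :: real^2"] by simp
  finally show ?thesis .
qed

lemma mass_test_fun: "mass test_fun UNIV = unit_ball_vol 2"
proof -
  have "mass test_fun UNIV = measure lborel (ball 0 1 - {0} :: (real^2) set)"
    unfolding mass_UNIV test_fun_square by (simp add: test_fun_def)
  then show ?thesis using measure_punctured_ball[of 1] by simp
qed

text \<open>Polarisation expresses the product through squares.\<close>

lemma integrable_prod:
  assumes "even_L2 F" "even_L2 G"
  shows "integrable lborel (\<lambda>v. F v * G v)"
proof -
  have "integrable lborel (\<lambda>v. ((1 * F v + 1 * G v)\<^sup>2 - (1 * F v + (- 1) * G v)\<^sup>2) / 4)"
    by (intro integrable_divide Bochner_Integration.integrable_diff integrable_lincomb_sq assms)
  moreover have "((1 * F v + 1 * G v)\<^sup>2 - (1 * F v + (- 1) * G v)\<^sup>2) / 4 = F v * G v" for v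
    by (simp add: power2_eq_square algebra_simps)
  ultimately show ?thesis by simp
qed

text \<open>The disc of radius \<open>1 / mat_norm M\<close> lies in the unit disc and is mapped
  into it by \<open>M\<close>; its area is the left side.\<close>

lemma overlap_ge:
  assumes "det M = 1"
  shows "unit_ball_vol 2 / (mat_norm M)\<^sup>2 \<le> (\<integral>v. test_fun v * test_fun (M *v v) \<partial>lborel)"
proof -
  let ?r = "1 / mat_norm M"
  let ?B = "ball 0 ?r - {0} :: (real^2) set"
  have m1: "mat_norm M \<ge> 1" by (rule mat_norm_ge_1[OF assms])
  have fin: "integrable lborel (indicator ?B :: real^2 \<Rightarrow> real)"
    by (intro integrable_real_indicator emeasure_bounded_finite bounded_subset[OF bounded_ball Diff_subset]) simp
  have "unit_ball_vol 2 / (mat_norm M)\<^sup>2 = measure lborel ?B"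
    using measure_punctured_ball[of ?r] m1 by (simp add: power_divide)
  also have "\<dots> = (\<integral>v. indicator ?B v \<partial>lborel)" by simp
  also have "\<dots> \<le> (\<integral>v. test_fun v * test_fun (M *v v) \<partial>lborel)"
  proof (rule integral_mono)
    show "integrable lborel (indicator ?B :: real^2 \<Rightarrow> real)" by (rule fin)
    show "integrable lborel (\<lambda>v. test_fun v * test_fun (M *v v))"
      by (intro integrable_prod even_L2_mult_vec even_L2_test_fun assms)
    fix v :: "real^2"
    show "indicator ?B v \<le> test_fun v * test_fun (M *v v)"
    proof (cases "v \<in> ?B")
      case True
      \<comment> \<open>Invertibility keeps the image of \<open>v\<close> off the puncture.\<close>
      obtain N where N: "N ** M = mat 1" using obtain_inverse[OF assms] .
      have "N *v (M *v v) = v" by (simp add: matrix_vector_mul_assoc N)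
      then have "M *v v \<noteq> 0" using True by auto
      moreover have "norm v < ?r" using True by simp
      moreover have "norm (M *v v) < 1"
      proof -
        have "norm (M *v v) \<le> mat_norm M * norm v" by (rule norm_mult_vec_le)
        also have "\<dots> < 1" using \<open>norm v < ?r\<close> m1 by (simp add: field_simps)
        finally show ?thesis .
      qed
      moreover have "?r \<le> 1" using m1 by simp
      ultimately show ?thesis using True by (simp add: test_fun_def indicator_def)
    qed (simp add: test_fun_def)
  qed
  finally show ?thesis .
qed

text \<open>By \<open>overlap_ge\<close> the mean inverse square norm is bounded by the inner
  product of the disc with its image under \<open>2 * k\<close> averaging steps, which
  Cauchy-Schwarz and the contraction bound by \<open>s\<close>.\<close>

lemma word_avg_inverse_square:
  assumes J: "J \<ge> 1"
  shows "word_avg (2 * k) (\<lambda>w. 1 / (mat_norm (word_mat (pert J) w))\<^sup>2) \<le> sqrt (1 - gap J) ^ k"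
proof -
  let ?A = "pert J" and ?G = "(averaging (pert J) ^^ (2 * k)) test_fun" and ?V = "unit_ball_vol 2"
  define s where "s = sqrt (1 - gap J) ^ k"
  have s: "s > 0" and s2: "s\<^sup>2 = (1 - gap J) ^ k"
    using gap_bounds[OF J] by (simp_all add: s_def power_mult [symmetric] mult.commute[of k]) (simp add: power_mult)
  have G: "even_L2 ?G" "mass ?G UNIV \<le> s\<^sup>2 * ?V"
    using mass_averaging_power[OF even_L2_test_fun J, of k] by (auto simp: s2 mass_test_fun)
  have "?V * word_avg (2 * k) (\<lambda>w. 1 / (mat_norm (word_mat ?A w))\<^sup>2)
     = word_avg (2 * k) (\<lambda>w. ?V / (mat_norm (word_mat ?A w))\<^sup>2)"
    by (simp add: word_avg_mult [symmetric])
  also have "\<dots> \<le> word_avg (2 * k) (\<lambda>w. \<integral>v. test_fun v * test_fun (word_mat ?A w *v v) \<partial>lborel)"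
    by (intro word_avg_mono overlap_ge det_word_mat pert_in_cocycles)
  also have "\<dots> = (\<integral>v. word_avg (2 * k) (\<lambda>w. test_fun v * test_fun (word_mat ?A w *v v)) \<partial>lborel)"
    unfolding word_avg_def
    by (subst integral_divide_zero, subst Bochner_Integration.integral_sum)
      (auto intro!: integrable_prod even_L2_mult_vec even_L2_test_fun det_word_mat pert_in_cocycles)
  also have "\<dots> = (\<integral>v. test_fun v * ?G v \<partial>lborel)"
    by (simp add: word_avg_mult word_avg_averaging)
  also have "\<dots> \<le> (\<integral>v. s / 2 * (test_fun v)\<^sup>2 + 1 / (2 * s) * (?G v)\<^sup>2 \<partial>lborel)"
  proof (rule integral_mono)
    show "integrable lborel (\<lambda>v. test_fun v * ?G v)" by (intro integrable_prod even_L2_test_fun G)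
    show "integrable lborel (\<lambda>v. s / 2 * (test_fun v)\<^sup>2 + 1 / (2 * s) * (?G v)\<^sup>2)"
      by (intro Bochner_Integration.integrable_add integrable_mult_right even_L2_integrable even_L2_test_fun G)
    fix v
    \<comment> \<open>Weighted form of Cauchy-Schwarz; with weight \<open>s\<close> the two halves
      contribute equal bounds.\<close>
    have "p * q \<le> s / 2 * p\<^sup>2 + 1 / (2 * s) * q\<^sup>2" for p q
    proof -
      have "s / 2 * p\<^sup>2 + 1 / (2 * s) * q\<^sup>2 - p * q = (s * p - q)\<^sup>2 / (2 * s)"
        using s by (simp add: power2_eq_square field_simps)
      also have "\<dots> \<ge> 0" using s by simp
      finally show ?thesis by simp
    qed
    then show "test_fun v * ?G v \<le> s / 2 * (test_fun v)\<^sup>2 + 1 / (2 * s) * (?G v)\<^sup>2" .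
  qed
  also have "\<dots> = s / 2 * ?V + 1 / (2 * s) * mass ?G UNIV"
    using even_L2_integrable[OF even_L2_test_fun] even_L2_integrable[OF G(1)]
    by (simp add: mass_UNIV flip: mass_test_fun)
  also have "\<dots> \<le> s / 2 * ?V + 1 / (2 * s) * (s\<^sup>2 * ?V)"
    using G(2) s by (intro add_left_mono mult_left_mono) auto
  also have "\<dots> = ?V * s" using s by (simp add: power2_eq_square field_simps)
  finally show ?thesis unfolding s_def [symmetric] by (simp add: unit_ball_vol_2)
qed

text \<open>Jensen's inequality, by comparing the exponential with its tangent line at the
  mean.\<close>

lemma exp_word_avg_le: "exp (- 2 * word_avg n g) \<le> word_avg n (\<lambda>w. exp (- 2 * g w))"
proof -
  let ?m = "word_avg n g"
  have "exp (- 2 * ?m) = exp (- 2 * ?m) * word_avg n (\<lambda>w. (1 + 2 * ?m) + (- 2) * g w)"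
    unfolding word_avg_add word_avg_mult by simp
  also have "\<dots> = word_avg n (\<lambda>w. exp (- 2 * ?m) * ((1 + 2 * ?m) + (- 2) * g w))"
    by (simp add: word_avg_mult)
  also have "\<dots> \<le> word_avg n (\<lambda>w. exp (- 2 * g w))"
  proof (rule word_avg_mono)
    fix w
    have "1 + (2 * ?m - 2 * g w) \<le> exp (2 * ?m - 2 * g w)" by (rule exp_ge_add_one_self)
    then have "exp (- 2 * ?m) * (1 + (2 * ?m - 2 * g w)) \<le> exp (- 2 * ?m) * exp (2 * ?m - 2 * g w)"
      by (intro mult_left_mono) auto
    then show "exp (- 2 * ?m) * ((1 + 2 * ?m) + (- 2) * g w) \<le> exp (- 2 * g w)"
      by (simp add: mult_exp_exp add_diff_eq)
  qed
  finally show ?thesis .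
qed

lemma word_avg_ln_norm_even_ge:
  assumes J: "J \<ge> 1"
  shows "real k * gap J / 4 \<le> word_avg (2 * k) (\<lambda>w. ln (mat_norm (word_mat (pert J) w)))"
proof -
  let ?a = "word_avg (2 * k) (\<lambda>w. ln (mat_norm (word_mat (pert J) w)))"
  have pos: "mat_norm (word_mat (pert J) w) > 0" for w
    using mat_norm_ge_1[OF det_word_mat[OF pert_in_cocycles]] by (meson less_le_trans zero_less_one)
  have e: "exp (- 2 * ln (mat_norm (word_mat (pert J) w))) = 1 / (mat_norm (word_mat (pert J) w))\<^sup>2" for w
    using pos[of w] by (simp add: exp_minus exp_double field_simps)
  have "exp (- 2 * ?a) \<le> sqrt (1 - gap J) ^ k"
    using exp_word_avg_le[of "2 * k" "\<lambda>w. ln (mat_norm (word_mat (pert J) w))"] word_avg_inverse_square[OF J, of k]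
    unfolding e by linarith
  also have "\<dots> \<le> exp (- gap J / 2) ^ k"
  proof (intro power_mono real_le_lsqrt)
    show "1 - gap J \<le> (exp (- gap J / 2))\<^sup>2"
      using exp_ge_add_one_self[of "- gap J"] by (simp add: exp_double [symmetric])
  qed (use gap_bounds[OF J] in auto)
  also have "\<dots> = exp (real k * (- gap J / 2))" by (rule exp_of_nat_mult [symmetric])
  finally show ?thesis by simp
qed

section \<open>The Lyapunov exponent near (C, D)\<close>

text \<open>\<open>K\<close> collects the logarithms of the norms of both letters and of both
  inverses, all nonnegative, so it dominates each of them.\<close>

lemma subadditive_ln_norm:
  assumes A: "A \<in> cocycles"
  obtains K where "subadditive_on_words (\<lambda>w. ln (mat_norm (word_mat A w))) K"
proof -
  have det: "det (fst A) = 1" "det (snd A) = 1" using A by (auto simp: cocycles_def SL2_def)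
  obtain N1 where N1: "N1 ** fst A = mat 1" "fst A ** N1 = mat 1" "det N1 = 1" using obtain_inverse[OF det(1)] .
  obtain N2 where N2: "N2 ** snd A = mat 1" "snd A ** N2 = mat 1" "det N2 = 1" using obtain_inverse[OF det(2)] .
  define K where "K = ln (mat_norm (letter A 1)) + ln (mat_norm (letter A 2)) + ln (mat_norm N1) + ln (mat_norm N2)"
  have ge1: "1 \<le> mat_norm (word_mat A w)" "1 \<le> mat_norm (letter A a)" for w a
    by (intro mat_norm_ge_1 det_word_mat det_letter A)+
  have N_ge1: "1 \<le> mat_norm N1" "1 \<le> mat_norm N2" by (intro mat_norm_ge_1 N1 N2)+
  have ln_le: "ln (mat_norm (M ** N)) \<le> ln (mat_norm M) + ln (mat_norm N)"
    if "1 \<le> mat_norm M" "1 \<le> mat_norm N" "1 \<le> mat_norm (M ** N)" for M N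
  proof -
    have "ln (mat_norm (M ** N)) \<le> ln (mat_norm M * mat_norm N)"
      using that by (intro ln_mono mat_norm_mult_le) linarith
    then show ?thesis using that by (simp add: ln_mult)
  qed
  have l12: "letter A a = letter A 1 \<or> letter A a = letter A 2" for a by (simp add: letter_def)
  have ln0: "0 \<le> ln (mat_norm (letter A 1))" "0 \<le> ln (mat_norm (letter A 2))"
    "0 \<le> ln (mat_norm N1)" "0 \<le> ln (mat_norm N2)"
    using ge1 N_ge1 by (simp_all only: ln_ge_zero)
  have "subadditive_on_words (\<lambda>w. ln (mat_norm (word_mat A w))) K"
  proof
    fix u w :: "nat list" and a :: nat
    show "0 \<le> ln (mat_norm (word_mat A w))" using ge1(1) by (rule ln_ge_zero)
    show "ln (mat_norm (word_mat A [])) = 0" by simp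
    have "1 \<le> mat_norm (word_mat A w ** word_mat A u)"
      using ge1(1)[of "u @ w"] unfolding word_mat_append .
    then have "ln (mat_norm (word_mat A w ** word_mat A u)) \<le> ln (mat_norm (word_mat A w)) + ln (mat_norm (word_mat A u))"
      by (rule ln_le[OF ge1(1) ge1(1)])
    then show "ln (mat_norm (word_mat A (u @ w))) \<le> ln (mat_norm (word_mat A u)) + ln (mat_norm (word_mat A w))"
      by (simp add: word_mat_append add.commute)
    show "ln (mat_norm (word_mat A [a])) \<le> K"
      using l12[of a] ln0 by (auto simp: K_def)
    have "\<exists>N. letter A a ** N = mat 1 \<and> 1 \<le> mat_norm N \<and> ln (mat_norm N) \<le> K"
    proof (cases "a = 1")
      case True
      then show ?thesis using N1 N_ge1 ln0 by (intro exI[of _ N1]) (auto simp: letter_def K_def)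
    next
      case False
      then show ?thesis using N2 N_ge1 ln0 by (intro exI[of _ N2]) (auto simp: letter_def K_def)
    qed
    then obtain N where N: "letter A a ** N = mat 1" "1 \<le> mat_norm N" "ln (mat_norm N) \<le> K" by blast
    have eq: "word_mat A w = word_mat A (a # w) ** N"
      by (simp add: N matrix_mul_assoc [symmetric])
    have "ln (mat_norm (word_mat A w)) \<le> ln (mat_norm (word_mat A (a # w))) + ln (mat_norm N)"
      using ln_le[OF ge1(1) N(2), of "a # w"] ge1(1)[of w] unfolding eq [symmetric] .
    with N(3) show "ln (mat_norm (word_mat A w)) \<le> ln (mat_norm (word_mat A (a # w))) + K" by linarith
  qed
  then show thesis by (rule that)
qed

lemma lyapunov_exponent_eq_INF:
  assumes "A \<in> cocycles"
  shows "lyapunov_exponent A = (INF n\<in>{1..}. word_avg n (\<lambda>w. ln (mat_norm (word_mat A w))) / real n)"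
proof -
  obtain K where "subadditive_on_words (\<lambda>w. ln (mat_norm (word_mat A w))) K"
    using subadditive_ln_norm[OF assms] .
  then interpret subadditive_on_words "\<lambda>w. ln (mat_norm (word_mat A w))" K .
  show ?thesis
    unfolding growth_def [symmetric]
    by (rule lyapunov_exponent_eqI) (use AE_tendsto_growth in \<open>simp add: cocycle_iterate_eq\<close>)
qed

text \<open>Carries the lower bound for words of even length over to words of every length.\<close>

lemma word_avg_ln_norm_double:
  assumes A: "A \<in> cocycles"
  shows "word_avg (2 * n) (\<lambda>w. ln (mat_norm (word_mat A w)))
    \<le> 2 * word_avg n (\<lambda>w. ln (mat_norm (word_mat A w)))"
proof -
  let ?f = "\<lambda>w. ln (mat_norm (word_mat A w))"
  obtain K where "subadditive_on_words ?f K" using subadditive_ln_norm[OF A] .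
  then interpret subadditive_on_words ?f K .
  have "word_avg (2 * n) ?f = word_avg n (\<lambda>u. word_avg n (\<lambda>w. ?f (u @ w)))"
    by (simp add: mult_2 word_avg_append)
  also have "\<dots> \<le> word_avg n (\<lambda>u. word_avg n (\<lambda>w. ?f u + ?f w))"
    by (intro word_avg_mono append)
  also have "\<dots> = 2 * word_avg n ?f" by (simp add: word_avg_add)
  finally show ?thesis .
qed

lemma lyapunov_exponent_pert_ge:
  assumes J: "J \<ge> 1"
  shows "gap J / 8 \<le> lyapunov_exponent (pert J)"
  unfolding lyapunov_exponent_eq_INF[OF pert_in_cocycles]
proof (rule cINF_greatest)
  fix n :: nat assume "n \<in> {1..}"
  moreover have "real n * gap J / 4 \<le> 2 * word_avg n (\<lambda>w. ln (mat_norm (word_mat (pert J) w)))"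
    using word_avg_ln_norm_even_ge[OF J, of n] word_avg_ln_norm_double[OF pert_in_cocycles] by (rule order_trans)
  ultimately show "gap J / 8 \<le> word_avg n (\<lambda>w. ln (mat_norm (word_mat (pert J) w))) / real n"
    by (simp add: field_simps)
qed simp

text \<open>Up to signs, the products of \<open>C_mat\<close> and \<open>D_mat\<close> are diagonal
  or antidiagonal. The first column has length \<open>exp s\<close> and lies on the first axis if
  \<open>d = 1\<close>, on the second if \<open>d = -1\<close>; so \<open>D_mat\<close> adds
  \<open>d\<close> to \<open>s\<close>, and \<open>C_mat\<close> flips \<open>d\<close>.\<close>

definition monomial :: "mat2 \<Rightarrow> real \<Rightarrow> real \<Rightarrow> bool" where
  "monomial M s d \<longleftrightarrow>
     d = 1 \<and> \<bar>M $ 1 $ 1\<bar> = exp s \<and> \<bar>M $ 2 $ 2\<bar> = exp (- s) \<and> M $ 1 $ 2 = 0 \<and> M $ 2 $ 1 = 0 \<or>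
     d = -1 \<and> \<bar>M $ 2 $ 1\<bar> = exp s \<and> \<bar>M $ 1 $ 2\<bar> = exp (- s) \<and> M $ 1 $ 1 = 0 \<and> M $ 2 $ 2 = 0"

lemma monomial_C: "monomial M s d \<Longrightarrow> monomial (C_mat ** M) s (- d)"
  by (auto simp: monomial_def C_mat_def matrix_matrix_mult_def sum_2)

lemma monomial_D: "monomial M s d \<Longrightarrow> monomial (D_mat ** M) (s + d) d"
  by (auto simp: monomial_def D_mat_def matrix_matrix_mult_def sum_2 abs_mult mult_exp_exp add.commute)

lemma mat_norm_monomial_le:
  assumes "monomial M s d"
  shows "mat_norm M \<le> exp \<bar>s\<bar>"
  unfolding mat_norm_def
proof (rule onorm_le)
  fix v :: "real^2"
  have bound: "(c * x)\<^sup>2 \<le> (exp \<bar>s\<bar>)\<^sup>2 * x\<^sup>2" if "\<bar>c\<bar> \<le> exp \<bar>s\<bar>" for c x :: real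
    using power_mono[OF that abs_ge_zero, of 2] by (simp add: power_mult_distrib mult_right_mono)
  have "(norm (M *v v))\<^sup>2 = (M $ 1 $ 1 * v $ 1 + M $ 1 $ 2 * v $ 2)\<^sup>2 + (M $ 2 $ 1 * v $ 1 + M $ 2 $ 2 * v $ 2)\<^sup>2"
    by (simp add: norm_vec_def L2_set_def sum_2 matrix_vector_mult_def)
  also have "\<dots> \<le> (exp \<bar>s\<bar>)\<^sup>2 * (v $ 1)\<^sup>2 + (exp \<bar>s\<bar>)\<^sup>2 * (v $ 2)\<^sup>2"
    using assms unfolding monomial_def
  proof (elim disjE conjE)
    assume *: "\<bar>M $ 1 $ 1\<bar> = exp s" "\<bar>M $ 2 $ 2\<bar> = exp (- s)" and zero: "M $ 1 $ 2 = 0" "M $ 2 $ 1 = 0"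
    then have "\<bar>M $ 1 $ 1\<bar> \<le> exp \<bar>s\<bar>" "\<bar>M $ 2 $ 2\<bar> \<le> exp \<bar>s\<bar>" by simp_all
    then show ?thesis using bound zero by (simp add: add_mono)
  next
    assume *: "\<bar>M $ 2 $ 1\<bar> = exp s" "\<bar>M $ 1 $ 2\<bar> = exp (- s)" and zero: "M $ 1 $ 1 = 0" "M $ 2 $ 2 = 0"
    then have "\<bar>M $ 2 $ 1\<bar> \<le> exp \<bar>s\<bar>" "\<bar>M $ 1 $ 2\<bar> \<le> exp \<bar>s\<bar>" by simp_all
    then have "(M $ 2 $ 1 * v $ 1)\<^sup>2 \<le> (exp \<bar>s\<bar>)\<^sup>2 * (v $ 1)\<^sup>2"
      "(M $ 1 $ 2 * v $ 2)\<^sup>2 \<le> (exp \<bar>s\<bar>)\<^sup>2 * (v $ 2)\<^sup>2"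
      by (simp_all add: bound)
    then show ?thesis unfolding zero by simp
  qed
  also have "\<dots> = (exp \<bar>s\<bar> * norm v)\<^sup>2"
    by (simp add: norm_vec_def L2_set_def sum_2 power_mult_distrib distrib_left)
  finally show "norm (M *v v) \<le> exp \<bar>s\<bar> * norm v"
    by (rule power2_le_imp_le) simp
qed

text \<open>
  \<open>s\<^sup>2 + s d\<close> grows by exactly 1 on average in each step of the walk \<open>(s, d) \<mapsto> (s, - d), (s + d, d)\<close>.
\<close>

lemma second_moment_C_D:
  assumes "monomial M s d" "det M = 1"
  shows "word_avg n (\<lambda>w. (ln (mat_norm (word_mat (C_mat, D_mat) w ** M)))\<^sup>2)
    \<le> 2 * (s\<^sup>2 + s * d + real n) + 1"
  using assms
proof (induction n arbitrary: M s d)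
  case 0
  have d: "d\<^sup>2 = 1" using 0 by (auto simp: monomial_def)
  have m: "1 \<le> mat_norm M" by (rule mat_norm_ge_1) fact
  then have "ln (mat_norm M) \<le> ln (exp \<bar>s\<bar>)"
    using mat_norm_monomial_le[OF 0(1)] by (intro ln_mono) auto
  then have "ln (mat_norm M) \<le> \<bar>s\<bar>" by simp
  then have "(ln (mat_norm M))\<^sup>2 \<le> \<bar>s\<bar>\<^sup>2" using m by (intro power_mono) auto
  \<comment> \<open>The difference of the two sides is \<open>(s + d)\<^sup>2\<close>, because
    \<open>d\<^sup>2 = 1\<close>.\<close>
  also have "\<bar>s\<bar>\<^sup>2 \<le> 2 * (s\<^sup>2 + s * d) + 1"
    using zero_le_power2[of "s + d"] d by (simp add: power2_sum algebra_simps)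
  finally show ?case by simp
next
  case (Suc n)
  have d: "d * d = 1" using Suc.prems by (auto simp: monomial_def)
  have det: "det (C_mat ** M) = 1" "det (D_mat ** M) = 1"
    using C_D_in_cocycles Suc.prems by (auto simp: det_mul cocycles_def SL2_def)
  have "word_avg n (\<lambda>w. (ln (mat_norm (word_mat (C_mat, D_mat) w ** (C_mat ** M))))\<^sup>2)
      \<le> 2 * (s\<^sup>2 + s * (- d) + real n) + 1"
    by (rule Suc.IH[OF monomial_C[OF Suc.prems(1)] det(1)])
  moreover have "word_avg n (\<lambda>w. (ln (mat_norm (word_mat (C_mat, D_mat) w ** (D_mat ** M))))\<^sup>2)
      \<le> 2 * ((s + d)\<^sup>2 + (s + d) * d + real n) + 1"
    by (rule Suc.IH[OF monomial_D[OF Suc.prems(1)] det(2)])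
  \<comment> \<open>Averaged with \<open>s\<^sup>2 - s * d\<close> from the letter
    \<open>C_mat\<close>, this gives \<open>s\<^sup>2 + s * d + 1\<close>.\<close>
  moreover have "(s + d)\<^sup>2 + (s + d) * d = s\<^sup>2 + 3 * (s * d) + 2"
    using d by (simp add: power2_eq_square algebra_simps)
  ultimately show ?case
    by (simp add: word_avg_Suc letter_def matrix_mul_assoc [symmetric] del: word_avg_mult)
qed

text \<open>The second moment of the log norm is linear in \<open>n\<close>, so its mean is of order
  at most the square root of \<open>n\<close>.\<close>

lemma lyapunov_exponent_C_D: "lyapunov_exponent (C_mat, D_mat) = 0"
proof (rule antisym)
  let ?A = "(C_mat, D_mat)"
  let ?a = "\<lambda>n. word_avg n (\<lambda>w. ln (mat_norm (word_mat ?A w)))"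
  have nonneg: "0 \<le> ?a n" for n
    using word_avg_mono[of n "\<lambda>_. 0" "\<lambda>w. ln (mat_norm (word_mat ?A w))"]
      mat_norm_ge_1[OF det_word_mat[OF C_D_in_cocycles]] by simp
  show "0 \<le> lyapunov_exponent ?A"
    unfolding lyapunov_exponent_eq_INF[OF C_D_in_cocycles]
    by (rule cINF_greatest) (auto simp: nonneg)
  show "lyapunov_exponent ?A \<le> 0"
  proof (rule field_le_epsilon)
    fix \<epsilon> :: real assume eps: "\<epsilon> > 0"
    obtain n :: nat where n: "real n > 3 / \<epsilon>\<^sup>2" using reals_Archimedean2 by blast
    have n1: "n \<ge> 1" using n eps by (cases n) (auto simp: divide_less_0_iff)
    \<comment> \<open>Weight for the bound of \<open>x\<close> by \<open>l / 2\<close> plus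
      \<open>x\<^sup>2 / (2 * l)\<close>: the choice of \<open>n\<close> gives
      \<open>3 * n \<le> l\<^sup>2\<close>, so each half contributes at most
      \<open>l / 2\<close>.\<close>
    define l where "l = \<epsilon> * real n"
    have l: "l > 0" using eps n1 by (simp add: l_def)
    have mono: "monomial (mat 1) 0 1" by (simp add: monomial_def mat_def)
    have "?a n \<le> word_avg n (\<lambda>w. l / 2 + 1 / (2 * l) * (ln (mat_norm (word_mat ?A w)))\<^sup>2)"
    proof (rule word_avg_mono)
      fix w
      have "x \<le> l / 2 + 1 / (2 * l) * x\<^sup>2" for x
      proof -
        have "l / 2 + 1 / (2 * l) * x\<^sup>2 - x = (x - l)\<^sup>2 / (2 * l)"
          using l by (simp add: power2_eq_square field_simps)
        also have "\<dots> \<ge> 0" using l by simp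
        finally show ?thesis by simp
      qed
      then show "ln (mat_norm (word_mat ?A w)) \<le> l / 2 + 1 / (2 * l) * (ln (mat_norm (word_mat ?A w)))\<^sup>2" .
    qed
    also have "\<dots> \<le> l / 2 + 1 / (2 * l) * (3 * real n)"
      unfolding word_avg_add word_avg_mult
      using second_moment_C_D[OF mono, of n] n1 l by (intro add_mono mult_left_mono) auto
    also have "\<dots> \<le> \<epsilon> * real n"
    proof -
      have "3 \<le> \<epsilon>\<^sup>2 * real n" using n eps by (simp add: field_simps)
      then have "3 * real n \<le> l\<^sup>2" using n1 by (simp add: l_def power2_eq_square)
      then have "1 / (2 * l) * (3 * real n) \<le> 1 / (2 * l) * l\<^sup>2" using l by (intro mult_left_mono) auto
      also have "\<dots> = l / 2" using l by (simp add: power2_eq_square)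
      finally show ?thesis by (simp add: l_def)
    qed
    finally have "?a n / real n \<le> \<epsilon>" using n1 by (simp add: field_simps)
    moreover have "lyapunov_exponent ?A \<le> ?a n / real n"
      unfolding lyapunov_exponent_eq_INF[OF C_D_in_cocycles]
      by (rule cINF_lower) (use n1 nonneg in \<open>auto intro!: bdd_belowI2[of _ 0]\<close>)
    ultimately show "lyapunov_exponent ?A \<le> 0 + \<epsilon>" by simp
  qed
qed

section \<open>Comparison with the moduli of continuity\<close>

lemma mat_norm_0 [simp]: "mat_norm 0 = 0"
proof -
  have "(*v) (0 :: mat2) = (\<lambda>v. 0)" by (simp add: fun_eq_iff)
  then show ?thesis by (simp add: mat_norm_def onorm_zero)
qed

text \<open>The difference has entries \<open>- t\<close>, \<open>t\<^sup>2\<close>, 0 and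
  \<open>t\<close>, so its norm lies between \<open>t\<close> and \<open>4 * t\<close>, and
  \<open>4 * t\<close> is at most \<open>exp (3 - 2 * J)\<close>.\<close>

lemma cocycle_dist_pert:
  assumes J: "J \<ge> 3"
  shows "0 < cocycle_dist (C_mat, D_mat) (pert J)" "cocycle_dist (C_mat, D_mat) (pert J) \<le> exp (- real J)"
proof -
  define t where "t = exp (1 - 2 * real J)"
  have t0: "t > 0" by (simp add: t_def)
  have t1: "t \<le> 1" using J by (simp add: t_def)
  let ?M = "C_mat - C_pert t"
  have M: "?M $ 1 $ 1 = - t" "?M $ 1 $ 2 = t\<^sup>2" "?M $ 2 $ 1 = 0" "?M $ 2 $ 2 = t"
    by (simp_all add: C_mat_def C_pert_def)
  have dist: "cocycle_dist (C_mat, D_mat) (pert J) = mat_norm ?M"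
    using mat_norm_nonneg[of ?M] by (simp add: cocycle_dist_def pert_def t_def)
  have "\<bar>(?M *v axis 1 1) $ 1\<bar> \<le> norm (?M *v axis 1 1)" by (rule component_le_norm_cart)
  also have "\<dots> \<le> mat_norm ?M" using norm_mult_vec_le[of ?M "axis 1 1"] by simp
  finally have "t \<le> mat_norm ?M"
    using M t0 by (simp add: matrix_vector_mult_basis column_def)
  then show "0 < cocycle_dist (C_mat, D_mat) (pert J)" using t0 unfolding dist by linarith
  have t2: "t\<^sup>2 \<le> t" using t0 t1 by (simp add: power2_eq_square mult_left_le)
  have "\<bar>?M $ i $ j\<bar> \<le> t" for i j
    using M t0 t2 exhaust_2[of i] exhaust_2[of j] by auto
  then have "mat_norm ?M \<le> real CARD(2) * real CARD(2) * t"
    unfolding mat_norm_def by (rule onorm_le_matrix_component)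
  also have "\<dots> = 4 * t" by simp
  also have "\<dots> \<le> exp 2 * t" using exp_2_ge_4 t0 by (intro mult_right_mono) auto
  also have "\<dots> = exp (3 - 2 * real J)" by (simp add: t_def mult_exp_exp)
  also have "\<dots> \<le> exp (- real J)" using J by simp
  finally show "cocycle_dist (C_mat, D_mat) (pert J) \<le> exp (- real J)" unfolding dist .
qed

lemma cocycle_dist_self: "cocycle_dist A A = 0"
  by (simp add: cocycle_dist_def)

text \<open>The exponent jumps by at least \<open>gap J / 8\<close> over a distance known only up to
  an upper bound; hence the smallness of the modulus is asked for at all radii up to
  \<open>exp (- J)\<close>.\<close>

lemma not_has_modulus_near_C_D:
  assumes small: "eventually (\<lambda>J. \<forall>r. 0 < r \<longrightarrow> r \<le> exp (- real J) \<longrightarrow> \<omega> r < gap J / 8) sequentially"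
    and eps: "\<epsilon> > 0"
  shows "\<not> has_modulus_on {x \<in> cocycles. cocycle_dist (C_mat, D_mat) x < \<epsilon>} cocycle_dist lyapunov_exponent \<omega>"
proof
  let ?A = "(C_mat, D_mat)"
  assume mod: "has_modulus_on {x \<in> cocycles. cocycle_dist ?A x < \<epsilon>} cocycle_dist lyapunov_exponent \<omega>"
  have "(\<lambda>J. exp (- real J)) \<longlonglongrightarrow> 0"
    by (intro filterlim_compose[OF exp_at_bot] filterlim_compose[OF filterlim_uminus_at_bot_at_top] filterlim_real_sequentially)
  then have "eventually (\<lambda>J. exp (- real J) < \<epsilon>) sequentially" using eps by (rule order_tendstoD)
  with small eventually_ge_at_top[of 3]
  have "eventually (\<lambda>J. False) sequentially"
  proof eventually_elim
    case (elim J)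
    let ?d = "cocycle_dist ?A (pert J)"
    have d: "0 < ?d" "?d \<le> exp (- real J)" using cocycle_dist_pert elim by auto
    then have ne: "?A \<noteq> pert J" using cocycle_dist_self[of ?A] by auto
    have "\<bar>lyapunov_exponent ?A - lyapunov_exponent (pert J)\<bar> \<le> \<omega> ?d"
      using ne d elim eps pert_in_cocycles C_D_in_cocycles
      by (intro mod[unfolded has_modulus_on_def, rule_format]) (auto simp: cocycle_dist_self)
    moreover have "gap J / 8 \<le> lyapunov_exponent (pert J)"
      using elim by (intro lyapunov_exponent_pert_ge) auto
    moreover have "\<omega> ?d < gap J / 8" using elim d by blast
    ultimately show False by (simp add: lyapunov_exponent_C_D)
  qed
  then show False by simp
qed

text \<open>Such a modulus is at most a constant times \<open>1 / J ^ 3\<close>, while the gap is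
  only of order \<open>1 / J\<^sup>2\<close>. The absolute value of \<open>K\<close> covers negative
  constants.\<close>

lemma superlogarithmic_modulus_small:
  assumes p: "eventually (\<lambda>J. 3 * ln (real J) \<le> p J) sequentially"
    and le: "eventually (\<lambda>J. \<forall>r. 0 < r \<longrightarrow> r \<le> exp (- real J) \<longrightarrow> \<omega> r \<le> \<bar>K\<bar> * exp (- p J)) sequentially"
  shows "eventually (\<lambda>J. \<forall>r. 0 < r \<longrightarrow> r \<le> exp (- real J) \<longrightarrow> \<omega> r < gap J / 8) sequentially"
proof -
  \<comment> \<open>The number is \<open>8 * 320000\<close>, from \<open>gap J / 8\<close>.\<close>
  obtain J0 :: nat where J0: "real J0 > 2560000 * \<bar>K\<bar>" using reals_Archimedean2 by blast
  show ?thesis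
    using p le eventually_ge_at_top[of "max 1 J0"]
  proof eventually_elim
    case (elim J)
    have J: "real J > 0" "real J > 2560000 * \<bar>K\<bar>" using elim(3) J0 by auto
    have "exp (- p J) \<le> exp (- (3 * ln (real J)))" using elim(1) by simp
    also have "\<dots> = 1 / (real J) ^ 3"
      using J exp_of_nat_mult[of 3 "ln (real J)"] by (simp add: exp_minus inverse_eq_divide)
    finally have "\<bar>K\<bar> * exp (- p J) \<le> \<bar>K\<bar> * (1 / (real J) ^ 3)" by (intro mult_left_mono) auto
    also have "\<dots> < gap J / 8"
      using J by (simp add: gap_def field_simps power2_eq_square power3_eq_cube)
    finally show ?case using elim(2) by fastforce
  qed
qed

lemma eventually_ln_le_powr:
  assumes "a > 0" "s > 0"
  shows "eventually (\<lambda>J. 3 * ln (real J) \<le> a * real J powr s) sequentially"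
proof -
  have "(\<lambda>J. ln (real J) / real J powr s) \<longlonglongrightarrow> 0" by (rule lim_ln_over_power[OF assms(2)])
  then have "eventually (\<lambda>J. ln (real J) / real J powr s < a / 3) sequentially"
    using assms(1) by (intro order_tendstoD) auto
  with eventually_gt_at_top[of 0] show ?thesis
    by eventually_elim (simp add: field_simps)
qed

text \<open>The surplus power \<open>\<gamma> - 1\<close> of \<open>ln J\<close> tends to infinity
  and eventually exceeds 3.\<close>

lemma eventually_ln_le_ln_powr:
  assumes "\<gamma> > 1"
  shows "eventually (\<lambda>J. 3 * ln (real J) \<le> ln (real J) powr \<gamma>) sequentially"
proof -
  have "filterlim (\<lambda>J. ln (real J)) at_top sequentially"
    by (intro filterlim_compose[OF ln_at_top] filterlim_real_sequentially)
  then have "eventually (\<lambda>J. ln (real J) \<ge> max 1 (3 powr (1 / (\<gamma> - 1)))) sequentially"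
    unfolding filterlim_at_top by blast
  then show ?thesis
  proof eventually_elim
    case (elim J)
    let ?l = "ln (real J)"
    have l: "?l > 0" using elim by simp
    have "3 = (3 powr (1 / (\<gamma> - 1))) powr (\<gamma> - 1)" using assms by (simp add: powr_powr)
    also have "\<dots> \<le> ?l powr (\<gamma> - 1)" using elim assms by (intro powr_mono2) auto
    finally have "3 * ?l \<le> ?l powr (\<gamma> - 1) * ?l" using l by (intro mult_right_mono) auto
    also have "\<dots> = ?l powr \<gamma>" using l powr_mult_base[of ?l "\<gamma> - 1"] by (simp add: mult.commute)
    finally show ?case .
  qed
qed

lemma ln_inverse_ge: "0 < r \<Longrightarrow> r \<le> exp (- x) \<Longrightarrow> x \<le> ln (1 / r)" for r x :: real
  using ln_le_cancel_iff[of r "exp (- x)"] by (simp add: ln_div)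

lemma log_Holder_modulus_small:
  assumes "\<gamma> > 1" "\<beta> \<ge> 1"
  shows "eventually (\<lambda>J. \<forall>r. 0 < r \<longrightarrow> r \<le> exp (- real J) \<longrightarrow>
    K * exp (- \<beta> * (ln (ln (1 / r))) powr \<gamma>) < gap J / 8) sequentially"
proof (rule superlogarithmic_modulus_small[where p = "\<lambda>J. ln (real J) powr \<gamma>" and K = K])
  show "eventually (\<lambda>J. \<forall>r. 0 < r \<longrightarrow> r \<le> exp (- real J) \<longrightarrow>
    K * exp (- \<beta> * (ln (ln (1 / r))) powr \<gamma>) \<le> \<bar>K\<bar> * exp (- (ln (real J) powr \<gamma>))) sequentially"
    using eventually_ge_at_top[of 1]
  proof eventually_elim
    case (elim J)
    show ?case
    proof (intro allI impI)
      fix r assume r: "0 < r" "r \<le> exp (- real J)"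
      have "real J \<le> ln (1 / r)" by (rule ln_inverse_ge) (use r in auto)
      then have "ln (real J) \<le> ln (ln (1 / r))" using elim by (intro ln_mono) auto
      then have "ln (real J) powr \<gamma> \<le> ln (ln (1 / r)) powr \<gamma>" using elim assms by (intro powr_mono2) auto
      also have "\<dots> \<le> \<beta> * ln (ln (1 / r)) powr \<gamma>"
        using assms mult_right_mono[of 1 \<beta> "ln (ln (1 / r)) powr \<gamma>"] by simp
      finally show "K * exp (- \<beta> * (ln (ln (1 / r))) powr \<gamma>) \<le> \<bar>K\<bar> * exp (- (ln (real J) powr \<gamma>))"
        by (intro mult_mono) auto
    qed
  qed
qed (rule eventually_ln_le_ln_powr[OF assms(1)])

lemma weak_Holder_modulus_small:
  assumes "\<alpha> > 0" "\<theta> > 0"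
  shows "eventually (\<lambda>J. \<forall>r. 0 < r \<longrightarrow> r \<le> exp (- real J) \<longrightarrow>
    K * exp (- \<alpha> * (ln (1 / r)) powr \<theta>) < gap J / 8) sequentially"
proof (rule superlogarithmic_modulus_small[where p = "\<lambda>J. \<alpha> * real J powr \<theta>" and K = K])
  show "eventually (\<lambda>J. \<forall>r. 0 < r \<longrightarrow> r \<le> exp (- real J) \<longrightarrow>
    K * exp (- \<alpha> * (ln (1 / r)) powr \<theta>) \<le> \<bar>K\<bar> * exp (- (\<alpha> * real J powr \<theta>))) sequentially"
  proof (intro always_eventually allI impI)
    fix J :: nat and r :: real assume r: "0 < r" "r \<le> exp (- real J)"
    have "real J \<le> ln (1 / r)" by (rule ln_inverse_ge) (use r in auto)
    then have "real J powr \<theta> \<le> ln (1 / r) powr \<theta>" using assms by (intro powr_mono2) auto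
    then have "\<alpha> * real J powr \<theta> \<le> \<alpha> * ln (1 / r) powr \<theta>" using assms by (intro mult_left_mono) auto
    then show "K * exp (- \<alpha> * (ln (1 / r)) powr \<theta>) \<le> \<bar>K\<bar> * exp (- (\<alpha> * real J powr \<theta>))"
      by (intro mult_mono) auto
  qed
qed (rule eventually_ln_le_powr[OF assms])

lemma Holder_modulus_small:
  assumes "\<alpha> > 0"
  shows "eventually (\<lambda>J. \<forall>r. 0 < r \<longrightarrow> r \<le> exp (- real J) \<longrightarrow> K * r powr \<alpha> < gap J / 8) sequentially"
proof (rule superlogarithmic_modulus_small[where p = "\<lambda>J. \<alpha> * real J powr 1" and K = K])
  show "eventually (\<lambda>J. \<forall>r. 0 < r \<longrightarrow> r \<le> exp (- real J) \<longrightarrow>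
    K * r powr \<alpha> \<le> \<bar>K\<bar> * exp (- (\<alpha> * real J powr 1))) sequentially"
  proof (intro always_eventually allI impI)
    fix J :: nat and r :: real assume r: "0 < r" "r \<le> exp (- real J)"
    have "r powr \<alpha> \<le> exp (- real J) powr \<alpha>" using r assms by (intro powr_mono2) auto
    also have "\<dots> = exp (- (\<alpha> * real J powr 1))" by (simp add: powr_def)
    finally show "K * r powr \<alpha> \<le> \<bar>K\<bar> * exp (- (\<alpha> * real J powr 1))"
      by (intro mult_mono) auto
  qed
qed (rule eventually_ln_le_powr[OF assms zero_less_one])

theorem theorem2:
  "(\<forall>\<gamma> \<beta>. \<gamma> > 1 \<longrightarrow> \<beta> \<ge> 1 \<longrightarrow>
      \<not> holds_at (log_Holder_on \<gamma> \<beta>) cocycles cocycle_dist lyapunov_exponent (C_mat, D_mat)) \<and>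
   \<not> holds_at weak_Holder_on cocycles cocycle_dist lyapunov_exponent (C_mat, D_mat) \<and>
   \<not> holds_at Holder_on cocycles cocycle_dist lyapunov_exponent (C_mat, D_mat)"
proof (intro conjI allI impI)
  fix \<gamma> \<beta> :: real assume "\<gamma> > 1" "\<beta> \<ge> 1"
  then show "\<not> holds_at (log_Holder_on \<gamma> \<beta>) cocycles cocycle_dist lyapunov_exponent (C_mat, D_mat)"
    unfolding holds_at_def log_Holder_on_def
    using not_has_modulus_near_C_D[OF log_Holder_modulus_small] by blast
next
  show "\<not> holds_at weak_Holder_on cocycles cocycle_dist lyapunov_exponent (C_mat, D_mat)"
    unfolding holds_at_def weak_Holder_on_def
    using not_has_modulus_near_C_D[OF weak_Holder_modulus_small] by blast
next
  show "\<not> holds_at Holder_on cocycles cocycle_dist lyapunov_exponent (C_mat, D_mat)"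
    unfolding holds_at_def Holder_on_def
    using not_has_modulus_near_C_D[OF Holder_modulus_small] by blast
qed

end
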